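(* Let $(u^{(i)},u^{\mathrm{ref}},v^{(i)},\hat q^{(i)})_{i=1,\dots,N}$ be the solution of the closed-loop system described in the context, and let $\widetilde u^{(i)}=u^{(i)}-u^{\mathrm{ref}}$ be the tracking errors. Let $\sigma\in(0,\lambda)$ be arbitrary. Then for every $i\in\{1,\dots,N\}$ and every $t>0$, $$\left\|\widetilde u^{(i)}(\cdot,t)\right\|_{C([0,1])}\le \widetilde{\mathcal C}_i\,\mathcal D(t)+\widetilde{\mathcal C}_i\,e^{-\sigma t}\left(\max_{1\le n\le N}\left\|\widetilde u^{(n)}_0\right\|_{C([0,1])}+\max_{1\le n\le N}\left\|u^{(n)}_0-v^{(n)}_0-\hat q^{(n)}_0\right\|_{C([0,1])}\right),$$ where $$\mathcal D(t)=\frac{2}{\lambda-\sigma}\max_{n}\left\|f^{(n)}\right\|_{C(\overline Q_t)}+\max_n\left\|d^{(n)}_0\right\|_{C([0,t])}+\frac1l\max_n\left\|d^{(n)}_1\right\|_{C([0,t])},$$ $$\widetilde{\mathcal C}_i=1+\frac{k_i}{l}\,\mathcal C_{i-1},\qquad \mathcal C_i=\frac{\mathcal M_i}{1-\mathcal N},\qquad \mathcal N=\frac{\prod_{n=1}^N k_n}{l^N},$$ $$\mathcal M_i=1+\sum_{m=1}^{i}\frac{\prod_{r=0}^{m-1}k_{i-r}}{l^m}+\sum_{m=i+1}^{N-1}\frac{\left(\prod_{r=0}^{i-1}k_{i-r}\right)\left(\prod_{s=0}^{m-i-1}k_{N-s}\right)}{l^m}.$$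
   Context: Notation: $\mathbb{R}_{\ge0}=[0,\infty)$, $\mathbb{R}_{>0}=(0,\infty)$, $Q_\infty=(0,1)\times\mathbb{R}_{>0}$, $\overline Q_\infty=[0,1]\times\mathbb{R}_{\ge0}$, $\overline Q_t=[0,1]\times[0,t]$. $\|h\|_{C(K)}=\max_{K}|h|$ for continuous $h$ on a compact set $K$. Subscripts $t,x$ denote partial derivatives. $N\ge2$ is an integer; $i$ ranges over $\{1,\dots,N\}$; any nonpositive index $m$ is read as $m+N$ (so $u^{(0)}=u^{(N)}$, $\mathcal C_0=\mathcal C_N$, etc.); empty sums are $0$. Constants: $\alpha>0$, $\lambda>0$, $l>0$, and gains $k_i\in(0,l)$. Closed-loop system, for $(x,t)\in Q_\infty$ (boundary conditions for $t>0$, initial conditions for $x\in(0,1)$): Agents: $u^{(i)}_t=\alpha u^{(i)}_{xx}-\lambda u^{(i)}+f^{(i)}$, $u^{(i)}(0,t)=q^{(i)}(t)+U^{(i)}_0(t)$, $u^{(i)}_x(1,t)=-l\,u^{(i)}(1,t)+U^{(i)}_1(t)$, $u^{(i)}(x,0)=u^{(i)}_0(x)$. Reference: $u^{\mathrm{ref}}_t=\alpha u^{\mathrm{ref}}_{xx}-\lambda u^{\mathrm{ref}}$, $u^{\mathrm{ref}}(0,t)=r(t)$, $u^{\mathrm{ref}}_x(1,t)=-l\,u^{\mathrm{ref}}(1,t)$, $u^{\mathrm{ref}}(x,0)=u^{\mathrm{ref}}_0(x)$. Auxiliary system: $v^{(i)}_t=\alpha v^{(i)}_{xx}-\lambda v^{(i)}$,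 $v^{(i)}(0,t)=U^{(i)}_0(t)$, $v^{(i)}_x(1,t)=-l\,v^{(i)}(1,t)+U^{(i)}_1(t)$, $v^{(i)}(x,0)=v^{(i)}_0(x)$. Disturbance observer: $\hat q^{(i)}_t=\alpha\hat q^{(i)}_{xx}-\lambda\hat q^{(i)}$, $\hat q^{(i)}_x(0,t)=u^{(i)}_x(0,t)-v^{(i)}_x(0,t)$, $\hat q^{(i)}_x(1,t)=-l\,\hat q^{(i)}(1,t)$, $\hat q^{(i)}(x,0)=\hat q^{(i)}_0(x)$. Control laws: $U^{(i)}_0(t)=r(t)-\hat q^{(i)}(0,t)+d^{(i)}_0(t)$ and $U^{(i)}_1(t)=k_i\big(u^{(i-1)}(1,t)-u^{\mathrm{ref}}(1,t)\big)+d^{(i)}_1(t)$. Hence the tracking error $\widetilde u^{(i)}=u^{(i)}-u^{\mathrm{ref}}$, with $\widetilde u^{(i)}_0=u^{(i)}_0-u^{\mathrm{ref}}_0$, satisfies $\widetilde u^{(i)}_t=\alpha\widetilde u^{(i)}_{xx}-\lambda\widetilde u^{(i)}+f^{(i)}$, $\widetilde u^{(i)}(0,t)=q^{(i)}(t)+d^{(i)}_0(t)-\hat q^{(i)}(0,t)$, $\widetilde u^{(i)}_x(1,t)=-l\,\widetilde u^{(i)}(1,t)+k_i\widetilde u^{(i-1)}(1,t)+d^{(i)}_1(t)$, $\widetilde u^{(i)}(x,0)=\widetilde u^{(i)}_0(x)$. Standing assumptions: $f^{(i)}\in C(\overline Q_\infty)$; $d^{(i)}_0,d^{(i)}_1,q^{(i)},r\in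 C^1(\mathbb{R}_{\ge0})$; $\widetilde u^{(i)}_0,u^{\mathrm{ref}}_0,v^{(i)}_0\in H^2(0,1)\cap C([0,1])$; and the compatibility conditions $\widetilde u^{(i)}_0(0)=q^{(i)}(0)+d^{(i)}_0(0)-\hat q^{(i)}_0(0)$, $\widetilde u^{(i)}_{0x}(1)=-l\,\widetilde u^{(i)}_0(1)+k_i\widetilde u^{(i-1)}_0(1)+d^{(i)}_1(0)$, $u^{\mathrm{ref}}_0(0)=r(0)$, $u^{\mathrm{ref}}_{0x}(1)=-l\,u^{\mathrm{ref}}_0(1)$, $v^{(i)}_0(0)=U^{(i)}_0(0)$, $v^{(i)}_{0x}(1)=-l\,v^{(i)}_0(1)+U^{(i)}_1(0)$. The solution is a classical one, each component belonging to $C(\mathbb{R}_{\ge0};H^2(0,1))\cap C^1(\mathbb{R}_{\ge0};L^2(0,1))$. *)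

theory Defs
  imports "HOL-Analysis.Analysis"
begin

text \<open>
  Function spaces over \<open>(0,1)\<close>.  Elements are represented by functions \<open>real \<Rightarrow> real\<close>,
  and only their restriction to \<open>(0,1)\<close>, up to null sets, matters.
\<close>

definition L2 :: "(real \<Rightarrow> real) set" where
  "L2 = {h. h \<in> borel_measurable (lebesgue_on {0<..<1}) \<and>
            integrable (lebesgue_on {0<..<1}) (\<lambda>x. (h x)\<^sup>2)}"

definition L2_norm :: "(real \<Rightarrow> real) \<Rightarrow> real" where
  "L2_norm h = sqrt (LINT x|lebesgue_on {0<..<1}. (h x)\<^sup>2)"

definition test_functions :: "(real \<Rightarrow> real) set" where
  "test_functions =
     {\<phi>. \<phi> C1_differentiable_on UNIV \<and>
         (\<exists>K. compact K \<and> K \<subseteq> {0<..<1} \<and> (\<forall>x. x \<notin> K \<longrightarrow> \<phi> x = 0))}"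

definition weak_deriv :: "(real \<Rightarrow> real) \<Rightarrow> (real \<Rightarrow> real) \<Rightarrow> bool" where
  "weak_deriv h g \<longleftrightarrow>
     (\<forall>\<phi>\<in>test_functions.
        (LINT x|lebesgue_on {0<..<1}. h x * deriv \<phi> x) =
        - (LINT x|lebesgue_on {0<..<1}. g x * \<phi> x))"

definition H1 :: "(real \<Rightarrow> real) set" where
  "H1 = {h \<in> L2. \<exists>g\<in>L2. weak_deriv h g}"

text \<open>For \<open>h \<in> H1\<close> the weak derivative is unique up to a null set; \<open>wderiv h\<close> picks a
  representative, so it should only be used under almost-everywhere quantifiers and integrals.\<close>

definition wderiv :: "(real \<Rightarrow> real) \<Rightarrow> (real \<Rightarrow> real)" where
  "wderiv h = (SOME g. g \<in> L2 \<and> weak_deriv h g)"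

definition H2 :: "(real \<Rightarrow> real) set" where
  "H2 = {h \<in> H1. wderiv h \<in> H1}"

definition H2_norm :: "(real \<Rightarrow> real) \<Rightarrow> real" where
  "H2_norm h = sqrt ((L2_norm h)\<^sup>2 + (L2_norm (wderiv h))\<^sup>2 + (L2_norm (wderiv (wderiv h)))\<^sup>2)"

text \<open>On compact \<open>K\<close> and for continuous \<open>h\<close> the supremum is attained, i.e. it is \<open>max\<^sub>K |h|\<close>.\<close>

definition C_norm :: "'a set \<Rightarrow> ('a \<Rightarrow> real) \<Rightarrow> real" where
  "C_norm K h = (SUP x\<in>K. \<bar>h x\<bar>)"

definition C1_nonneg :: "(real \<Rightarrow> real) \<Rightarrow> bool" where
  "C1_nonneg g \<longleftrightarrow>
     (\<exists>g'. continuous_on {0..} g' \<and>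
           (\<forall>t\<ge>0. (g has_real_derivative g' t) (at t within {0..})))"

text \<open>\<open>w \<in> C(\<real>\<^sub>\<ge>\<^sub>0; X)\<close> for a space \<open>X\<close> of functions normed by \<open>nrm\<close>; \<open>w x t\<close> is the value
  at the point \<open>x\<close> and the time \<open>t\<close>.\<close>

definition cont_into ::
  "(real \<Rightarrow> real) set \<Rightarrow> ((real \<Rightarrow> real) \<Rightarrow> real) \<Rightarrow> (real \<Rightarrow> real \<Rightarrow> real) \<Rightarrow> bool" where
  "cont_into X nrm w \<longleftrightarrow>
     (\<forall>t\<ge>0. (\<lambda>x. w x t) \<in> X) \<and>
     (\<forall>s\<ge>0. ((\<lambda>t. nrm (\<lambda>x. w x t - w x s)) \<longlongrightarrow> 0) (at s within {0..}))"

definition L2_time_deriv :: "(real \<Rightarrow> real \<Rightarrow> real) \<Rightarrow> (real \<Rightarrow> real \<Rightarrow> real) \<Rightarrow> bool" where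
  "L2_time_deriv w w' \<longleftrightarrow>
     (\<forall>s\<ge>0. ((\<lambda>t. L2_norm (\<lambda>x. (w x t - w x s) / (t - s) - w' x s)) \<longlongrightarrow> 0)
              (at s within {0..}))"

text \<open>
  A classical (in the semigroup sense) solution of \<open>w\<^sub>t = \<alpha> w\<^sub>x\<^sub>x - lam w + f\<close> on
  \<open>(0,1) \<times> \<real>\<^sub>>\<^sub>0\<close>: \<open>w \<in> C(\<real>\<^sub>\<ge>\<^sub>0; H\<^sup>2(0,1)) \<inter> C\<^sup>1(\<real>\<^sub>\<ge>\<^sub>0; L\<^sup>2(0,1))\<close>, and the equation holds in
  \<open>L\<^sup>2(0,1)\<close> for every \<open>t > 0\<close>.  In this regularity class \<open>w\<^sub>t\<close> and \<open>w\<^sub>x\<^sub>x\<close> are, at each time,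
  elements of \<open>L\<^sup>2(0,1)\<close>.  The first conjunct selects the continuous representative of each
  \<open>w(\<cdot>,t)\<close>, so that its values at \<open>x = 0\<close> and \<open>x = 1\<close> are meaningful.
\<close>

definition classical_solution ::
  "real \<Rightarrow> real \<Rightarrow> (real \<Rightarrow> real \<Rightarrow> real) \<Rightarrow> (real \<Rightarrow> real \<Rightarrow> real) \<Rightarrow> bool" where
  "classical_solution \<alpha> lam f w \<longleftrightarrow>
     (\<forall>t\<ge>0. continuous_on {0..1} (\<lambda>x. w x t)) \<and>
     cont_into H2 H2_norm w \<and>
     (\<exists>w'. L2_time_deriv w w' \<and> cont_into L2 L2_norm w' \<and>
        (\<forall>t>0. AE x in lebesgue_on {0<..<1}.
           w' x t = \<alpha> * wderiv (wderiv (\<lambda>y. w y t)) x - lam * w x t + f x t))"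

text \<open>The derivative at \<open>a \<in> [0,1]\<close>, one-sided at the end points.  It exists for the
  continuous representative of an \<open>H\<^sup>2(0,1)\<close> function, which is of class \<open>C\<^sup>1\<close> on \<open>[0,1]\<close>.\<close>

definition dx :: "(real \<Rightarrow> real) \<Rightarrow> real \<Rightarrow> real" where
  "dx h a = vector_derivative h (at a within {0..1})"

text \<open>Agents are numbered \<open>1, \<dots>, N\<close> cyclically; the only nonpositive index that occurs is \<open>0\<close>.\<close>

definition wrap :: "nat \<Rightarrow> nat \<Rightarrow> nat" where
  "wrap N m = (if m = 0 then N else m)"

definition M_const :: "nat \<Rightarrow> (nat \<Rightarrow> real) \<Rightarrow> real \<Rightarrow> nat \<Rightarrow> real" where
  "M_const N k l i =
     1 + (\<Sum>m=1..i. (\<Prod>r<m. k (i - r)) / l ^ m)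
       + (\<Sum>m=i+1..N-1. ((\<Prod>r<i. k (i - r)) * (\<Prod>s<m-i. k (N - s))) / l ^ m)"

definition N_const :: "nat \<Rightarrow> (nat \<Rightarrow> real) \<Rightarrow> real \<Rightarrow> real" where
  "N_const N k l = (\<Prod>n=1..N. k n) / l ^ N"

definition C_const :: "nat \<Rightarrow> (nat \<Rightarrow> real) \<Rightarrow> real \<Rightarrow> nat \<Rightarrow> real" where
  "C_const N k l i = M_const N k l i / (1 - N_const N k l)"

definition C_tilde :: "nat \<Rightarrow> (nat \<Rightarrow> real) \<Rightarrow> real \<Rightarrow> nat \<Rightarrow> real" where
  "C_tilde N k l i = 1 + k i / l * C_const N k l (wrap N (i - 1))"

definition D_fun ::
  "nat \<Rightarrow> real \<Rightarrow> real \<Rightarrow> real \<Rightarrow> (nat \<Rightarrow> real \<Rightarrow> real \<Rightarrow> real) \<Rightarrow>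
   (nat \<Rightarrow> real \<Rightarrow> real) \<Rightarrow> (nat \<Rightarrow> real \<Rightarrow> real) \<Rightarrow> real \<Rightarrow> real" where
  "D_fun N l lam \<sigma> f d0 d1 t =
     2 / (lam - \<sigma>) * Max ((\<lambda>n. C_norm ({0..1} \<times> {0..t}) (\<lambda>(x, s). f n x s)) ` {1..N})
     + Max ((\<lambda>n. C_norm {0..t} (d0 n)) ` {1..N})
     + 1 / l * Max ((\<lambda>n. C_norm {0..t} (d1 n)) ` {1..N})"

end

theory Submission
  imports Defs
begin

text \<open>
  If \<open>w\<^sub>t = \<alpha> w\<^sub>x\<^sub>x - lam w + f\<close> and \<open>M\<close> is large compared with the data, then
  \<open>\<integral> ((w - M exp (- \<sigma> t))\<^sub>+)\<^sup>3 dx\<close> vanishes initially and does not increase, which bounds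
  \<open>w\<close> by \<open>M exp (- \<sigma> t)\<close>.  The cube keeps the test function \<open>3 (w - M exp (- \<sigma> t))\<^sub>+\<^sup>2\<close>
  continuously differentiable in \<open>x\<close>, and its convexity bounds difference quotients in time
  by integrals against \<open>w\<^sub>t\<close>.

  This applies first to the observer error \<open>u\<^sup>i - v\<^sup>i - qh\<^sup>i\<close>, whose boundary conditions are
  homogeneous (Neumann at \<open>0\<close>, Robin at \<open>1\<close>), and then to the tracking errors, which it feeds
  through their Dirichlet datum.  With \<open>E\<^sub>i\<close> the supremum of \<open>exp (\<sigma> s) \<bar>ut\<^sup>i\<bar>\<close> over
  \<open>[0,1] \<times> [0,T]\<close> and \<open>G = exp (\<sigma> T) D(T) + ...\<close> this gives \<open>E\<^sub>i \<le> G + (k\<^sub>i / l) E\<^sub>i\<^sub>-\<^sub>1\<close>,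
  a cyclic system of contractions whose fixed point dominates the \<open>E\<^sub>i\<close>.
\<close>

subsection \<open>Integration by parts against an indefinite integral\<close>

text \<open>The obstacle is the weak sense of the equation: w_t is only an L^2 limit of difference
  quotients and w_xx only a weak derivative up to null sets, so neither can be evaluated at a
  maximum point. Hence the comparison by an integral functional. The equation enters it as the
  statement that \<alpha> w_x is a primitive of w_t + lam w - f, which must be extracted from a
  definition by test functions.

  The disturbances \<open>q i\<close> do not occur in the bound. They act only through the value of
  u - v at x = 0, so that q - qh there is the boundary value of the observer error, and this is what
  the observer controls.

  The data in D(T) need not decay, whereas the level M exp(-\<sigma> t) does. On [0,T] a constant X
  lies below X exp(\<sigma> T) exp(-\<sigma> t), and at t = T the exponentials cancel; this is the
  origin of exp(\<sigma> T) in G. Relative to the decaying level the reaction term keeps the rate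
  lam - \<sigma>, so a source bounded by F costs F / (lam - \<sigma>).\<close>

lemma absolutely_integrable_continuous_mult:
  fixes f g :: "real \<Rightarrow> real"
  assumes "continuous_on {a..b} f" "g absolutely_integrable_on {a..b}"
  shows "(\<lambda>x. f x * g x) absolutely_integrable_on {a..b}"
proof (rule absolutely_integrable_bounded_measurable_product_real)
  show "f \<in> borel_measurable (lebesgue_on {a..b})"
    using assms(1) by (intro continuous_imp_measurable_on_sets_lebesgue) auto
  show "bounded (f ` {a..b})"
    using assms(1) compact_continuous_image compact_imp_bounded by blast
qed (use assms in auto)

text \<open>Here \<open>p\<close> is only a primitive of an integrable function, as w_x is for a
  solution in H^2, while \<open>z\<close> is continuously differentiable. The lemma serves twice:
  with a test function to identify weak derivatives, and with the squared positive part in the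
  maximum principle.\<close>

lemma integration_by_parts_indefinite:
  fixes g p z z' :: "real \<Rightarrow> real"
  assumes ab: "a \<le> b"
    and g: "g absolutely_integrable_on {a..b}"
    and p: "\<And>x. x \<in> {a..b} \<Longrightarrow> p x = p a + integral {a..x} g"
    and z: "\<And>x. x \<in> {a..b} \<Longrightarrow> (z has_real_derivative z' x) (at x within {a..b})"
    and z': "continuous_on {a..b} z'"
  shows "((\<lambda>x. z x * g x + z' x * p x) has_integral (z b * p b - z a * p a)) {a..b}"
proof -
  have g_int: "g integrable_on {a..b}" and g_abs: "(\<lambda>x. \<bar>g x\<bar>) integrable_on {a..b}"
    using g by (auto simp: absolutely_integrable_on_def)
  have z_cont: "continuous_on {a..b} z"
    using z DERIV_continuous_on by blast
  have p_cont: "continuous_on {a..b} p"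
  proof (rule continuous_on_eq)
    show "continuous_on {a..b} (\<lambda>x. p a + integral {a..x} g)"
      by (intro continuous_on_add continuous_on_const indefinite_integral_continuous_1 g_int)
  qed (metis p)
  have zg: "(\<lambda>x. z x * g x) integrable_on {a..b}"
    using absolutely_integrable_continuous_mult[OF z_cont g]
    by (simp add: absolutely_integrable_on_def)
  have zp: "(\<lambda>x. z' x * p x) integrable_on {a..b}"
    by (intro integrable_continuous_real continuous_intros z' p_cont)
  define h where "h = (\<lambda>x. z x * g x + z' x * p x)"
  have h_int: "h integrable_on {a..b}"
    unfolding h_def by (intro integrable_add zg zp)
  have sub: "f integrable_on {x..y}" if "f integrable_on {a..b}" "a \<le> x" "y \<le> b"
    for f :: "real \<Rightarrow> real" and x y
    using integrable_on_subinterval[OF that(1), of x y] that by auto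
  have comb: "integral {x..y} f = integral {a..y} f - integral {a..x} f"
    if "f integrable_on {a..b}" "a \<le> x" "x \<le> y" "y \<le> b" for f :: "real \<Rightarrow> real" and x y
    using Henstock_Kurzweil_Integration.integral_combine[of a x y f] sub[OF that(1), of a y] that by auto
  obtain L where L: "\<And>x. x \<in> {a..b} \<Longrightarrow> \<bar>z' x\<bar> \<le> L" "L \<ge> 0"
  proof -
    have "bounded (z' ` {a..b})"
      using z' compact_continuous_image compact_imp_bounded by blast
    then obtain L where "\<forall>y \<in> z' ` {a..b}. \<bar>y\<bar> \<le> L" by (auto simp: bounded_iff)
    then have "\<And>x. x \<in> {a..b} \<Longrightarrow> \<bar>z' x\<bar> \<le> max L 0" by force
    then show thesis using that[of "max L 0"] by auto
  qed
  \<comment> \<open>\<open>p\<close> may fail to be differentiable on an uncountable set, but the defect \<open>R\<close> of the formula has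
    increments \<open>o(\<bar>y - x\<bar>)\<close>, so \<open>R' = 0\<close> everywhere.\<close>
  define R where "R = (\<lambda>x. z x * p x - integral {a..x} h)"
  \<comment> \<open>The total variation of \<open>p\<close> up to \<open>x\<close>. It bounds the
    increments of \<open>p\<close>, and its continuity is what makes the increments of
    \<open>R\<close> of smaller order than \<open>y - x\<close>.\<close>
  define G where "G = (\<lambda>x. integral {a..x} (\<lambda>s. \<bar>g s\<bar>))"
  have G_cont: "continuous_on {a..b} G"
    unfolding G_def by (rule indefinite_integral_continuous_1[OF g_abs])
  \<comment> \<open>The increment of \<open>R\<close> is the integral over \<open>{x..y}\<close> of
    (z y - z s) g s + z' s (p x - p s). In each summand the oscillation of one factor meets the
    integral of the other, which gives L (y - x) (G y - G x) twice.\<close>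
  have est: "\<bar>R y - R x\<bar> \<le> 2 * L * (y - x) * (G y - G x)" if xy: "a \<le> x" "x \<le> y" "y \<le> b" for x y
  proof -
    have G: "G y - G x = integral {x..y} (\<lambda>s. \<bar>g s\<bar>)"
      unfolding G_def using comb[OF g_abs xy] by simp
    have pd: "p s - p x = integral {x..s} g" if "s \<in> {x..y}" for s
      using comb[OF g_int, of x s] p[of s] p[of x] that xy by auto
    have pbd: "\<bar>p x - p s\<bar> \<le> G y - G x" if "s \<in> {x..y}" for s
    proof -
      have "\<bar>p x - p s\<bar> = \<bar>integral {x..s} g\<bar>" using pd[OF that] by linarith
      also have "\<dots> \<le> integral {x..s} (\<lambda>s. \<bar>g s\<bar>)"
        using integral_norm_bound_integral[of g "{x..s}" "\<lambda>s. \<bar>g s\<bar>"]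
          sub[OF g_int, of x s] sub[OF g_abs, of x s] that xy by auto
      also have "\<dots> \<le> integral {x..y} (\<lambda>s. \<bar>g s\<bar>)"
        using that xy by (intro integral_subset_le sub[OF g_abs]) auto
      finally show ?thesis using G by simp
    qed
    have zbd: "\<bar>z y - z s\<bar> \<le> L * (y - x)" if "s \<in> {x..y}" for s
    proof -
      have "norm (z y - z s) \<le> L * norm (y - s)"
        using that xy z L by (intro field_differentiable_bound[of "{a..b}" z z' L y s]) auto
      also have "\<dots> \<le> L * (y - x)" using that L by (intro mult_left_mono) auto
      finally show ?thesis by simp
    qed
    have i1: "(\<lambda>s. z y * g s) integrable_on {x..y}"
      using sub[OF g_int, of x y] xy by (intro integrable_on_mult_right) auto
    have i2: "(\<lambda>s. z s * g s) integrable_on {x..y}" using sub[OF zg] xy by auto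
    have i3: "(\<lambda>s. z' s * p x) integrable_on {x..y}"
      using sub[OF integrable_continuous_real[OF z'], of x y] xy by (intro integrable_on_mult_left) auto
    have i4: "(\<lambda>s. z' s * p s) integrable_on {x..y}" using sub[OF zp] xy by auto
    have zy: "z y - z x = integral {x..y} z'"
    proof -
      have "(z' has_integral (z y - z x)) {x..y}"
      proof (rule fundamental_theorem_of_calculus)
        show "(z has_vector_derivative z' s) (at s within {x..y})" if "s \<in> {x..y}" for s
          using DERIV_subset[OF z[of s], of "{x..y}"] that xy
          by (simp add: has_real_derivative_iff_has_vector_derivative)
      qed (use xy in simp)
      then show ?thesis by (simp add: integral_unique)
    qed
    have hs: "integral {x..y} h = integral {x..y} (\<lambda>s. z s * g s) + integral {x..y} (\<lambda>s. z' s * p s)"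
      unfolding h_def by (rule integral_add[OF i2 i4])
    have "R y - R x = z y * p y - z x * p x - integral {x..y} h"
      unfolding R_def using comb[OF h_int xy] by simp
    also have "\<dots> = z y * (p y - p x) + (z y - z x) * p x - integral {x..y} h"
      by (simp add: algebra_simps)
    also have "\<dots> = integral {x..y} (\<lambda>s. z y * g s) + integral {x..y} (\<lambda>s. z' s * p x)
                - integral {x..y} h"
      using pd[of y] xy zy by simp
    also have "\<dots> = (integral {x..y} (\<lambda>s. z y * g s) - integral {x..y} (\<lambda>s. z s * g s))
       + (integral {x..y} (\<lambda>s. z' s * p x) - integral {x..y} (\<lambda>s. z' s * p s))"
      unfolding hs by simp
    also have "\<dots> = integral {x..y} (\<lambda>s. z y * g s - z s * g s)
       + integral {x..y} (\<lambda>s. z' s * p x - z' s * p s)"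
      by (simp add: integral_diff i1 i2 i3 i4)
    finally have "\<bar>R y - R x\<bar> \<le> \<bar>integral {x..y} (\<lambda>s. z y * g s - z s * g s)\<bar>
       + \<bar>integral {x..y} (\<lambda>s. z' s * p x - z' s * p s)\<bar>" by simp
    also have "\<bar>integral {x..y} (\<lambda>s. z y * g s - z s * g s)\<bar>
        \<le> integral {x..y} (\<lambda>s. L * (y - x) * \<bar>g s\<bar>)"
    proof -
      have "norm (z y * g s - z s * g s) \<le> L * (y - x) * \<bar>g s\<bar>" if "s \<in> {x..y}" for s
        using mult_right_mono[OF zbd[OF that], of "\<bar>g s\<bar>"]
        by (simp add: abs_mult left_diff_distrib[symmetric])
      moreover have "(\<lambda>s. z y * g s - z s * g s) integrable_on {x..y}"
        by (rule integrable_diff[OF i1 i2])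
      moreover have "(\<lambda>s. L * (y - x) * \<bar>g s\<bar>) integrable_on {x..y}"
        using sub[OF g_abs, of x y] xy by (intro integrable_on_mult_right) auto
      ultimately have "norm (integral {x..y} (\<lambda>s. z y * g s - z s * g s))
          \<le> integral {x..y} (\<lambda>s. L * (y - x) * \<bar>g s\<bar>)"
        by (intro integral_norm_bound_integral)
      then show ?thesis by (simp only: real_norm_def)
    qed
    also have "\<dots> = L * (y - x) * (G y - G x)" unfolding G by simp
    also have "\<bar>integral {x..y} (\<lambda>s. z' s * p x - z' s * p s)\<bar> \<le> integral {x..y} (\<lambda>s. L * (G y - G x))"
    proof -
      have "norm (z' s * p x - z' s * p s) \<le> L * (G y - G x)" if "s \<in> {x..y}" for s
        using mult_mono[OF L(1)[of s] pbd[OF that]] that xy L(2)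
        by (simp add: abs_mult right_diff_distrib[symmetric])
      then have "norm (integral {x..y} (\<lambda>s. z' s * p x - z' s * p s))
          \<le> integral {x..y} (\<lambda>s. L * (G y - G x))"
        by (intro integral_norm_bound_integral integrable_diff[OF i3 i4] integrable_const_ivl) auto
      then show ?thesis by (simp only: real_norm_def)
    qed
    also have "\<dots> = L * (y - x) * (G y - G x)" using xy by (simp add: algebra_simps)
    finally show ?thesis by simp
  qed
  have "(R has_real_derivative 0) (at x within {a..b})" if x: "x \<in> {a..b}" for x
  proof -
    have Gx: "((\<lambda>y. 2 * L * \<bar>G y - G x\<bar>) \<longlongrightarrow> 0) (at x within {a..b})"
    proof -
      have "(G \<longlongrightarrow> G x) (at x within {a..b})"
        using G_cont x by (auto simp: continuous_on_def)
      then have "((\<lambda>y. 2 * L * \<bar>G y - G x\<bar>) \<longlongrightarrow> 2 * L * \<bar>G x - G x\<bar>) (at x within {a..b})"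
        by (intro tendsto_intros)
      then show ?thesis by simp
    qed
    have "norm ((R y - R x) / (y - x)) \<le> 2 * L * \<bar>G y - G x\<bar>" if y: "y \<in> {a..b}" "y \<noteq> x" for y
    proof -
      have "\<bar>R y - R x\<bar> \<le> 2 * L * \<bar>y - x\<bar> * \<bar>G y - G x\<bar>"
      proof (cases "x \<le> y")
        case True
        have "2 * L * (y - x) * (G y - G x) \<le> 2 * L * (y - x) * \<bar>G y - G x\<bar>"
          using True L by (intro mult_left_mono) auto
        then show ?thesis using est[of x y] True x y by auto
      next
        case False
        have "2 * L * (x - y) * (G x - G y) \<le> 2 * L * (x - y) * \<bar>G y - G x\<bar>"
          using False L by (intro mult_left_mono) auto
        then show ?thesis using est[of y x] False x y by (auto simp: abs_minus_commute)
      qed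
      then show ?thesis using y(2) by (simp add: divide_le_eq mult_ac)
    qed
    then have "((\<lambda>y. (R y - R x) / (y - x)) \<longlongrightarrow> 0) (at x within {a..b})"
      by (intro Lim_null_comparison[OF _ Gx]) (auto simp: eventually_at_filter)
    then show ?thesis by (simp add: has_field_derivative_iff)
  qed
  then have "((\<lambda>x. 0) has_integral (R b - R a)) {a..b}"
    using ab by (intro fundamental_theorem_of_calculus)
      (auto simp flip: has_real_derivative_iff_has_vector_derivative)
  then have "R b = R a" by (simp add: has_integral_iff)
  then have "integral {a..b} h = z b * p b - z a * p a" unfolding R_def by simp
  then show ?thesis using h_int unfolding h_def by (simp add: has_integral_iff)
qed

subsection \<open>Sobolev functions on the unit interval\<close>

lemma absolutely_integrable_iff_integrable_unit:
  fixes f :: "real \<Rightarrow> real"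
  shows "f absolutely_integrable_on {0..1} \<longleftrightarrow> integrable (lebesgue_on {0<..<1}) f"
proof -
  have "f absolutely_integrable_on {0..1} \<longleftrightarrow> f absolutely_integrable_on {0<..<1}"
    by (simp add: absolutely_integrable_on_def integrable_on_Icc_iff_Ioo)
  also have "\<dots> \<longleftrightarrow> integrable (lebesgue_on {0<..<1}) f"
    unfolding set_integrable_def by (subst integrable_restrict_space) auto
  finally show ?thesis .
qed

lemma integral_unit_eq:
  fixes f :: "real \<Rightarrow> real"
  assumes "f absolutely_integrable_on {0..1}"
  shows "(LINT x|lebesgue_on {0<..<1}. f x) = integral {0..1} f"
  using assms
  by (simp add: absolutely_integrable_iff_integrable_unit lebesgue_integral_eq_integral
      integral_open_interval_real)

lemma AE_unit_imp_negligible: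
  assumes "AE x in lebesgue_on {0<..<1::real}. P x"
  obtains N where "negligible N" "\<And>x. x \<in> {0..1} - N \<Longrightarrow> P x"
proof -
  have "AE x in lebesgue. x \<in> {0<..<1} \<longrightarrow> P x"
    using assms by (subst (asm) AE_restrict_space_iff) auto
  then obtain N where N: "{x \<in> space lebesgue. \<not> (x \<in> {0<..<1} \<longrightarrow> P x)} \<subseteq> N"
      "N \<in> null_sets lebesgue"
    unfolding eventually_ae_filter by auto
  show thesis
  proof
    \<comment> \<open>The measure lives on the open interval, so the end points are put into the
      exceptional set.\<close>
    show "negligible (N \<union> {0, 1})" using N(2) by (simp add: negligible_iff_null_sets)
    show "P x" if "x \<in> {0..1} - (N \<union> {0, 1})" for x
    proof -
      have "x \<in> {0<..<1}" "x \<notin> N" using that by auto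
      then show ?thesis using N(1) by (auto simp: subset_iff)
    qed
  qed
qed

section \<open>Square integrable functions on the unit interval\<close>

lemma L2_absolutely_integrable:
  assumes "h \<in> L2"
  shows "h absolutely_integrable_on {0..1}" and "integral {0..1} (\<lambda>x. \<bar>h x\<bar>) \<le> L2_norm h"
proof -
  let ?M = "lebesgue_on {0<..<1::real}"
  interpret M: finite_measure ?M by (rule finite_measure_lebesgue_on) auto
  have m: "h \<in> borel_measurable ?M" and sq: "integrable ?M (\<lambda>x. (h x)\<^sup>2)"
    using assms by (auto simp: L2_def)
  have measure: "measure ?M (space ?M) = 1" by (simp add: measure_restrict_space)
  have int: "integrable ?M h"
  proof (rule Bochner_Integration.integrable_bound)
    show "integrable ?M (\<lambda>x. 1 + (h x)\<^sup>2)" using sq by auto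
    have "\<bar>a\<bar> \<le> 1 + a\<^sup>2" for a :: real
    proof -
      have "0 \<le> (\<bar>a\<bar> - 1)\<^sup>2" by simp
      then have "2 * \<bar>a\<bar> \<le> 1 + a\<^sup>2" by (simp add: power2_diff)
      then show ?thesis by linarith
    qed
    then show "AE x in ?M. norm (h x) \<le> norm (1 + (h x)\<^sup>2)" by auto
  qed (rule m)
  then show ai: "h absolutely_integrable_on {0..1}"
    by (simp add: absolutely_integrable_iff_integrable_unit)
  define a where "a = (LINT x|?M. \<bar>h x\<bar>)"
  have ia: "integrable ?M (\<lambda>x. \<bar>h x\<bar>)" using int by (rule integrable_abs)
  \<comment> \<open>Cauchy-Schwarz as nonnegativity of a variance: the interval has measure 1, so
    \<open>a\<close> is the mean of the absolute value of \<open>h\<close>.\<close>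
  have "0 \<le> (LINT x|?M. (\<bar>h x\<bar> - a)\<^sup>2)" by simp
  also have "(\<lambda>x. (\<bar>h x\<bar> - a)\<^sup>2) = (\<lambda>x. (h x)\<^sup>2 - 2 * a * \<bar>h x\<bar> + a\<^sup>2)"
    by (auto simp: power2_diff algebra_simps)
  also have "(LINT x|?M. (h x)\<^sup>2 - 2 * a * \<bar>h x\<bar> + a\<^sup>2) = (LINT x|?M. (h x)\<^sup>2) - 2 * a * a + a\<^sup>2"
    using ia sq measure unfolding a_def by simp
  finally have "a\<^sup>2 \<le> (LINT x|?M. (h x)\<^sup>2)" by (simp add: power2_eq_square)
  then have "a \<le> L2_norm h" unfolding L2_norm_def by (rule real_le_rsqrt)
  moreover have "a = integral {0..1} (\<lambda>x. \<bar>h x\<bar>)"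
    unfolding a_def by (rule integral_unit_eq) (use ia in \<open>simp add: absolutely_integrable_iff_integrable_unit\<close>)
  ultimately show "integral {0..1} (\<lambda>x. \<bar>h x\<bar>) \<le> L2_norm h" by simp
qed

lemma L2_cmult: "h \<in> L2 \<Longrightarrow> (\<lambda>x. c * h x) \<in> L2"
  unfolding L2_def by (auto simp: power_mult_distrib)

lemma L2_diff:
  assumes "f \<in> L2" "g \<in> L2"
  shows "(\<lambda>x. f x - g x) \<in> L2"
proof -
  let ?M = "lebesgue_on {0<..<1::real}"
  have m: "f \<in> borel_measurable ?M" "g \<in> borel_measurable ?M"
    and sq: "integrable ?M (\<lambda>x. (f x)\<^sup>2)" "integrable ?M (\<lambda>x. (g x)\<^sup>2)"
    using assms by (auto simp: L2_def)
  have "integrable ?M (\<lambda>x. (f x - g x)\<^sup>2)"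
  proof (rule Bochner_Integration.integrable_bound)
    show "integrable ?M (\<lambda>x. 2 * (f x)\<^sup>2 + 2 * (g x)\<^sup>2)" using sq by auto
    show "(\<lambda>x. (f x - g x)\<^sup>2) \<in> borel_measurable ?M" using m by measurable
    have "(a - b)\<^sup>2 \<le> 2 * a\<^sup>2 + 2 * b\<^sup>2" for a b :: real
      using zero_le_power2[of "a + b"] by (simp add: power2_sum power2_diff)
    then show "AE x in ?M. norm ((f x - g x)\<^sup>2) \<le> norm (2 * (f x)\<^sup>2 + 2 * (g x)\<^sup>2)" by auto
  qed
  then show ?thesis using m by (simp add: L2_def)
qed

section \<open>Test functions and weak derivatives\<close>

lemma test_functionD:
  assumes "\<phi> \<in> test_functions"
  shows "(\<phi> has_real_derivative deriv \<phi> x) (at x)" and "continuous_on UNIV (deriv \<phi>)"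
    and "\<phi> 0 = 0" and "\<phi> 1 = 0"
proof -
  obtain D where D: "\<And>x. (\<phi> has_vector_derivative D x) (at x)" "continuous_on UNIV D"
    using assms unfolding test_functions_def C1_differentiable_on_def by auto
  then have "(\<phi> has_real_derivative D x) (at x)" for x
    by (simp add: has_real_derivative_iff_has_vector_derivative)
  then have "deriv \<phi> = D" by (auto intro: DERIV_imp_deriv)
  then show "(\<phi> has_real_derivative deriv \<phi> x) (at x)" "continuous_on UNIV (deriv \<phi>)"
    using D by (auto simp: has_real_derivative_iff_has_vector_derivative)
  show "\<phi> 0 = 0" "\<phi> 1 = 0" using assms unfolding test_functions_def by auto
qed

lemma test_function_continuous:
  assumes "\<phi> \<in> test_functions"
  shows "continuous_on S \<phi>" "continuous_on S (deriv \<phi>)"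
proof -
  show "continuous_on S \<phi>"
    by (rule DERIV_continuous_on[where D = "deriv \<phi>"])
       (rule has_field_derivative_at_within[OF test_functionD(1)[OF assms]])
  show "continuous_on S (deriv \<phi>)"
    by (rule continuous_on_subset[OF test_functionD(2)[OF assms]]) simp
qed

lemma test_function_products_integrable:
  assumes "\<phi> \<in> test_functions" "h absolutely_integrable_on {0..1}"
  shows "(\<lambda>x. h x * \<phi> x) absolutely_integrable_on {0..1}"
    and "(\<lambda>x. h x * deriv \<phi> x) absolutely_integrable_on {0..1}"
  using absolutely_integrable_continuous_mult[OF test_function_continuous(1)[OF assms(1)] assms(2)]
    absolutely_integrable_continuous_mult[OF test_function_continuous(2)[OF assms(1)] assms(2)]
  by (simp_all add: mult.commute)

lemma weak_deriv_iff:
  assumes "h absolutely_integrable_on {0..1}" "g absolutely_integrable_on {0..1}"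
  shows "weak_deriv h g \<longleftrightarrow> (\<forall>\<phi>\<in>test_functions.
    integral {0..1} (\<lambda>x. h x * deriv \<phi> x) = - integral {0..1} (\<lambda>x. g x * \<phi> x))"
  unfolding weak_deriv_def
  by (intro ball_cong refl)
     (simp add: integral_unit_eq test_function_products_integrable[OF _ assms(1)]
        test_function_products_integrable[OF _ assms(2)])

lemma weak_deriv_diff:
  assumes "h1 \<in> L2" "h2 \<in> L2" "g1 \<in> L2" "g2 \<in> L2" "weak_deriv h1 g1" "weak_deriv h2 g2"
  shows "weak_deriv (\<lambda>x. h1 x - h2 x) (\<lambda>x. g1 x - g2 x)"
proof -
  note ai = assms(1-4)[THEN L2_absolutely_integrable(1)]
  have int: "f integrable_on {0..1}" if "f absolutely_integrable_on {0..1}" for f :: "real \<Rightarrow> real"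
    using that by (simp add: absolutely_integrable_on_def)
  have "integral {0..1} (\<lambda>x. (h1 x - h2 x) * deriv \<phi> x)
      = - integral {0..1} (\<lambda>x. (g1 x - g2 x) * \<phi> x)" if \<phi>: "\<phi> \<in> test_functions" for \<phi>
  proof -
    have "integral {0..1} (\<lambda>x. (h1 x - h2 x) * deriv \<phi> x)
       = integral {0..1} (\<lambda>x. h1 x * deriv \<phi> x) - integral {0..1} (\<lambda>x. h2 x * deriv \<phi> x)"
      unfolding left_diff_distrib
      by (intro integral_diff int test_function_products_integrable(2)[OF \<phi>] ai)
    moreover have "integral {0..1} (\<lambda>x. (g1 x - g2 x) * \<phi> x)
       = integral {0..1} (\<lambda>x. g1 x * \<phi> x) - integral {0..1} (\<lambda>x. g2 x * \<phi> x)"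
      unfolding left_diff_distrib
      by (intro integral_diff int test_function_products_integrable(1)[OF \<phi>] ai)
    moreover have "integral {0..1} (\<lambda>x. h1 x * deriv \<phi> x) = - integral {0..1} (\<lambda>x. g1 x * \<phi> x)"
      using weak_deriv_iff[OF ai(1,3)] assms(5) \<phi> by blast
    moreover have "integral {0..1} (\<lambda>x. h2 x * deriv \<phi> x) = - integral {0..1} (\<lambda>x. g2 x * \<phi> x)"
      using weak_deriv_iff[OF ai(2,4)] assms(6) \<phi> by blast
    ultimately show ?thesis by simp
  qed
  then show ?thesis
    by (subst weak_deriv_iff) (use ai in \<open>auto intro: set_integral_diff(1)\<close>)
qed

lemma H1_wderiv:
  assumes "h \<in> H1"
  shows "h \<in> L2" "wderiv h \<in> L2" "weak_deriv h (wderiv h)"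
proof -
  have "\<exists>g. g \<in> L2 \<and> weak_deriv h g" using assms by (auto simp: H1_def)
  from someI_ex[OF this] show "wderiv h \<in> L2" "weak_deriv h (wderiv h)"
    by (simp_all add: wderiv_def)
  show "h \<in> L2" using assms by (simp add: H1_def)
qed

lemma H1_diff:
  assumes "f \<in> H1" "g \<in> H1"
  shows "(\<lambda>x. f x - g x) \<in> H1"
  unfolding H1_def
  using L2_diff[OF H1_wderiv(1)[OF assms(1)] H1_wderiv(1)[OF assms(2)]]
    L2_diff[OF H1_wderiv(2)[OF assms(1)] H1_wderiv(2)[OF assms(2)]]
    weak_deriv_diff[OF H1_wderiv(1)[OF assms(1)] H1_wderiv(1)[OF assms(2)]
      H1_wderiv(2)[OF assms(1)] H1_wderiv(2)[OF assms(2)]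
      H1_wderiv(3)[OF assms(1)] H1_wderiv(3)[OF assms(2)]]
  by (intro CollectI conjI bexI)

text \<open>The zero mean makes the primitive starting at 0 vanish again to the right of
  \<open>b\<close>, hence compactly supported in the open interval. So the derivatives of test
  functions include all continuous functions of mean zero supported in some \<open>{a..b}\<close>
  inside (0,1).\<close>

lemma test_function_antiderivative:
  fixes \<rho> :: "real \<Rightarrow> real"
  assumes cont: "continuous_on UNIV \<rho>" and ab: "0 < a" "b < 1"
    and supp: "\<And>x. x \<notin> {a..b} \<Longrightarrow> \<rho> x = 0"
    and zero: "integral {0..1} \<rho> = 0"
  obtains \<phi> where "\<phi> \<in> test_functions" "deriv \<phi> = \<rho>"
proof -
  define \<phi> where "\<phi> = (\<lambda>x. integral {0..x} \<rho>)"
  have left: "\<phi> x = 0" if "x < a" for x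
  proof -
    have "\<phi> x = integral {0..x} (\<lambda>x. 0)"
      unfolding \<phi>_def by (rule integral_cong) (use that supp in auto)
    then show ?thesis by simp
  qed
  have right: "\<phi> x = 0" if "b < x" for x
  proof -
    have "integral {0..x} \<rho> = integral {0..1} \<rho>"
      using that ab supp
      by (intro integral_spike_set negligible_subset[OF negligible_empty]) force+
    then show ?thesis using zero by (simp add: \<phi>_def)
  qed
  have D: "(\<phi> has_real_derivative \<rho> x) (at x)" for x
  proof -
    \<comment> \<open>The integral over \<open>{0..x}\<close> is a two-sided antiderivative only for
      \<open>x\<close> inside the unit interval; to the left of \<open>a\<close> and to the right of
      \<open>b\<close> the function is locally zero.\<close>
    consider "x < a" | "b < x" | "x \<in> {0<..<1}" using ab by fastforce
    then show ?thesis
    proof cases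
      case 1
      have "((\<lambda>x. 0) has_real_derivative \<rho> x) (at x)" using 1 supp by auto
      then show ?thesis
        by (rule has_field_derivative_transform_within_open[where S = "{..<a}"]) (use 1 left in auto)
    next
      case 2
      have "((\<lambda>x. 0) has_real_derivative \<rho> x) (at x)" using 2 supp by auto
      then show ?thesis
        by (rule has_field_derivative_transform_within_open[where S = "{b<..}"]) (use 2 right in auto)
    next
      case 3
      have "(\<phi> has_real_derivative \<rho> x) (at x within {0..1})"
        unfolding \<phi>_def using 3 continuous_on_subset[OF cont]
        by (intro integral_has_real_derivative) auto
      then show ?thesis using 3 by (simp add: at_within_Icc_at)
    qed
  qed
  show thesis
  proof
    have "\<phi> C1_differentiable_on UNIV"
      unfolding C1_differentiable_on_def using D cont
      by (auto simp: has_real_derivative_iff_has_vector_derivative)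
    moreover have "\<forall>x. x \<notin> {a..b} \<longrightarrow> \<phi> x = 0" using left right by auto
    moreover have "{a..b} \<subseteq> {0<..<1}" using ab by auto
    ultimately show "\<phi> \<in> test_functions" unfolding test_functions_def by blast
    show "deriv \<phi> = \<rho>" using D by (auto intro: DERIV_imp_deriv)
  qed
qed

text \<open>Piecewise linear plateaus with slopes of size \<open>n\<close>. They are used as
  ingredients of derivatives of test functions, and since \<open>test_functions\<close> asks for C^1
  only, continuity is enough.\<close>

definition trapezoid :: "real \<Rightarrow> real \<Rightarrow> nat \<Rightarrow> real \<Rightarrow> real" where
  "trapezoid a b n x = max 0 (min 1 (real n * min (x - a) (b - x)))"

lemma trapezoid_continuous: "continuous_on S (trapezoid a b n)"
  unfolding trapezoid_def by (intro continuous_intros)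

lemma trapezoid_bounds: "0 \<le> trapezoid a b n x" "trapezoid a b n x \<le> 1"
  by (auto simp: trapezoid_def)

lemma trapezoid_outside: "x \<notin> {a<..<b} \<Longrightarrow> trapezoid a b n x = 0"
proof -
  assume "x \<notin> {a<..<b}"
  then have "min (x - a) (b - x) \<le> 0" by auto
  then have "real n * min (x - a) (b - x) \<le> 0" by (rule mult_nonneg_nonpos[OF of_nat_0_le_iff])
  then show ?thesis by (simp add: trapezoid_def)
qed

lemma trapezoid_tendsto: "(\<lambda>n. trapezoid a b n x) \<longlonglongrightarrow> indicator {a<..<b} x"
proof (cases "x \<in> {a<..<b}")
  case True
  define m where "m = min (x - a) (b - x)"
  have m: "m > 0" using True by (auto simp: m_def)
  have "eventually (\<lambda>n. trapezoid a b n x = 1) sequentially"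
    using eventually_ge_at_top[of "nat \<lceil>1 / m\<rceil>"]
  proof eventually_elim
    case (elim n)
    then have "1 / m \<le> real n" by linarith
    then have "1 \<le> real n * m" using m by (simp add: field_simps)
    then show ?case by (simp add: trapezoid_def m_def)
  qed
  then show ?thesis using True tendsto_eventually by auto
next
  case False then show ?thesis by (simp add: trapezoid_outside)
qed

text \<open>Subtracting a multiple of one fixed bump from a continuous function supported inside
  (0,1) gives it mean zero and so makes it the derivative of a test function. Orthogonality then
  says that \<open>k\<close> integrates every such function like one constant, read off from the
  bump.\<close>

lemma du_Bois_Reymond:
  fixes k :: "real \<Rightarrow> real"
  assumes k: "k absolutely_integrable_on {0..1}"
    and orth: "\<And>\<phi>. \<phi> \<in> test_functions \<Longrightarrow> integral {0..1} (\<lambda>x. k x * deriv \<phi> x) = 0"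
  obtains c N where "negligible N" "\<And>x. x \<in> {0..1} - N \<Longrightarrow> k x = c"
proof -
  have int: "f integrable_on {0..1}" if "f absolutely_integrable_on {0..1}" for f :: "real \<Rightarrow> real"
    using that by (simp add: absolutely_integrable_on_def)
  have k_mult: "(\<lambda>x. k x * \<xi> x) absolutely_integrable_on {0..1}" if "continuous_on UNIV \<xi>" for \<xi>
    using absolutely_integrable_continuous_mult[OF continuous_on_subset[OF that subset_UNIV] k]
    by (simp add: mult.commute)
  define \<eta> where "\<eta> = trapezoid (1/4) (3/4) 1"
  define J where "J = integral {0..1} \<eta>"
  have \<eta>_cont: "continuous_on S \<eta>" for S unfolding \<eta>_def by (rule trapezoid_continuous)
  have J: "J \<noteq> 0"
  proof
    assume "J = 0"
    then have "\<forall>x\<in>{0..1}. \<eta> x = 0"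
      using integral_eq_0_iff[OF \<eta>_cont, of 0 1] trapezoid_bounds(1)
      unfolding J_def \<eta>_def by auto
    then have "\<eta> (1/2) = 0" by simp
    then show False by (simp add: \<eta>_def trapezoid_def)
  qed
  define c where "c = integral {0..1} (\<lambda>x. k x * \<eta> x) / J"
  have mean: "integral {0..1} (\<lambda>x. k x * \<xi> x) = c * integral {0..1} \<xi>"
    if \<xi>: "continuous_on UNIV \<xi>" and ab: "0 < a" "b < 1" and supp: "\<And>x. x \<notin> {a..b} \<Longrightarrow> \<xi> x = 0"
    for a b and \<xi> :: "real \<Rightarrow> real"
  proof -
    \<comment> \<open>The multiple of the bump that has the same integral as the given
      function.\<close>
    define r where "r = integral {0..1} \<xi> / J"
    define \<rho> where "\<rho> = (\<lambda>x. \<xi> x - r * \<eta> x)"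
    have \<xi>_int: "\<xi> integrable_on {0..1}"
      by (rule integrable_continuous_real[OF continuous_on_subset[OF \<xi> subset_UNIV]])
    have \<eta>_int: "\<eta> integrable_on {0..1}" by (rule integrable_continuous_real[OF \<eta>_cont])
    have "integral {0..1} \<rho> = integral {0..1} \<xi> - r * J"
      unfolding \<rho>_def J_def using \<xi>_int \<eta>_int
      by (subst integral_diff) (auto intro: integrable_on_mult_right)
    then have zero: "integral {0..1} \<rho> = 0" using J by (simp add: r_def)
    obtain \<phi> where \<phi>: "\<phi> \<in> test_functions" "deriv \<phi> = \<rho>"
    proof (rule test_function_antiderivative[of \<rho> "min a (1/4)" "max b (3/4)"])
      show "continuous_on UNIV \<rho>"
        unfolding \<rho>_def by (intro continuous_on_diff continuous_on_mult_left \<xi> \<eta>_cont)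
      show "\<rho> x = 0" if "x \<notin> {min a (1/4)..max b (3/4)}" for x
      proof -
        have "x \<notin> {a..b}" "x \<notin> {1/4<..<3/4}" using that by auto
        then show ?thesis by (simp add: \<rho>_def \<eta>_def supp trapezoid_outside)
      qed
    qed (use ab zero in auto)
    have "0 = integral {0..1} (\<lambda>x. k x * \<xi> x - r * (k x * \<eta> x))"
      using orth[OF \<phi>(1)] unfolding \<phi>(2) \<rho>_def by (simp add: algebra_simps)
    also have "\<dots> = integral {0..1} (\<lambda>x. k x * \<xi> x) - r * integral {0..1} (\<lambda>x. k x * \<eta> x)"
      using int[OF k_mult[OF \<xi>]] int[OF k_mult[OF \<eta>_cont]]
      by (subst integral_diff) (auto intro: integrable_on_mult_right)
    finally show ?thesis by (simp add: r_def c_def)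
  qed
  \<comment> \<open>Trapezoids increase to indicators, so \<open>k - c\<close> has zero integral over every interval and
    vanishes at its Lebesgue points.\<close>
  define k0 where "k0 = (\<lambda>x. k x - c)"
  have k0: "k0 absolutely_integrable_on {0..1}"
    unfolding k0_def by (intro set_integral_diff(1) k absolutely_integrable_continuous_real continuous_on_const)
  have interval: "integral {a<..<b} k0 = 0" if ab: "0 < a" "b < 1" for a b
  proof -
    have f_zero: "integral {0..1} (\<lambda>x. k0 x * trapezoid a b n x) = 0" for n
    proof -
      have "integral {0..1} (\<lambda>x. k0 x * trapezoid a b n x)
          = integral {0..1} (\<lambda>x. k x * trapezoid a b n x - c * trapezoid a b n x)"
        by (simp add: k0_def algebra_simps)
      also have "\<dots> = integral {0..1} (\<lambda>x. k x * trapezoid a b n x) - c * integral {0..1} (trapezoid a b n)"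
        using int[OF k_mult[OF trapezoid_continuous]]
        by (subst integral_diff)
           (auto intro: integrable_on_mult_right integrable_continuous_real trapezoid_continuous)
      also have "\<dots> = 0"
      proof -
        have "trapezoid a b n x = 0" if "x \<notin> {a..b}" for x
          using that by (intro trapezoid_outside) auto
        from mean[OF trapezoid_continuous ab this] show ?thesis by simp
      qed
      finally show ?thesis .
    qed
    have "(\<lambda>n. integral {0..1} (\<lambda>x. k0 x * trapezoid a b n x))
        \<longlonglongrightarrow> integral {0..1} (\<lambda>x. k0 x * indicator {a<..<b} x)"
    proof (rule dominated_convergence(2)[where h = "\<lambda>x. \<bar>k0 x\<bar>"])
      show "(\<lambda>x. k0 x * trapezoid a b n x) integrable_on {0..1}" for n
        using int[OF absolutely_integrable_continuous_mult[OF trapezoid_continuous k0]]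
        by (simp add: mult.commute)
      show "(\<lambda>x. \<bar>k0 x\<bar>) integrable_on {0..1}" using k0 by (simp add: absolutely_integrable_on_def)
      show "norm (k0 x * trapezoid a b n x) \<le> \<bar>k0 x\<bar>" for n x
        using trapezoid_bounds[of a b n x] by (simp add: abs_mult mult_left_le)
      show "(\<lambda>n. k0 x * trapezoid a b n x) \<longlonglongrightarrow> k0 x * indicator {a<..<b} x" for x
        by (intro tendsto_mult tendsto_const trapezoid_tendsto)
    qed
    then have "0 = integral {0..1} (\<lambda>x. k0 x * indicator {a<..<b} x)"
      unfolding f_zero by (simp add: LIMSEQ_const_iff)
    also have "(\<lambda>x. k0 x * indicator {a<..<b} x) = (\<lambda>x. if x \<in> {a<..<b} then k0 x else 0)"
      by (auto simp: indicator_def)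
    also have "integral {0..1} \<dots> = integral {a<..<b} k0"
    proof -
      have "{a<..<b} \<inter> {0..1} = {a<..<b}" using ab by auto
      then show ?thesis using integral_restrict_Int[of "{0..1}" "{a<..<b}" k0] by simp
    qed
    finally show ?thesis by simp
  qed
  define j where "j = (\<lambda>x. if x \<in> {0..1} then k0 x else 0)"
  have j_int: "j integrable_on cbox a b" for a b
  proof -
    have "j integrable_on UNIV" unfolding j_def
      using int[OF k0] by (simp only: integrable_restrict_UNIV)
    then show ?thesis by (rule integrable_on_subcbox) simp
  qed
  obtain N where N: "negligible N"
    "\<And>x e. \<lbrakk>x \<notin> N; 0 < e\<rbrakk> \<Longrightarrow>
       \<exists>d>0. \<forall>h. 0 < h \<and> h < d \<longrightarrow>
         norm (integral (cbox x (x + h *\<^sub>R One)) j /\<^sub>R h ^ DIM(real) - j x) < e"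
    by (rule integrable_ccontinuous_explicit[OF j_int]) (rule that)
  show thesis
  proof (rule that)
    show "negligible (N \<union> {0, 1})" using N(1) by simp
    fix x :: real assume x: "x \<in> {0..1} - (N \<union> {0, 1})"
    show "k x = c"
    proof (rule ccontr)
      assume "k x \<noteq> c"
      then have "\<bar>j x\<bar> > 0" using x by (auto simp: j_def k0_def)
      \<comment> \<open>The tolerance is the value of \<open>j\<close> itself: short averages to the
        right of \<open>x\<close> would then be nonzero, whereas they vanish by
        \<open>interval\<close>.\<close>
      then obtain d where d: "d > 0"
        "\<And>h. 0 < h \<Longrightarrow> h < d \<Longrightarrow> \<bar>integral {x..x + h} j / h - j x\<bar> < \<bar>j x\<bar>"
        using N(2)[of x "\<bar>j x\<bar>"] x by (auto simp: divide_inverse mult.commute)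
      define h where "h = min (d / 2) ((1 - x) / 2)"
      have h: "0 < h" "h < d" "x + h < 1" using d(1) x by (auto simp: h_def min_def field_simps)
      have "integral {x..x + h} j = integral {x<..<x + h} j" by (rule integral_open_interval_real)
      also have "\<dots> = integral {x<..<x + h} k0"
        by (rule integral_cong) (use x h in \<open>auto simp: j_def\<close>)
      also have "\<dots> = 0" by (rule interval) (use x h in auto)
      finally show False using d(2)[OF h(1,2)] by simp
    qed
  qed
qed

text \<open>Integration by parts shows that the primitive of \<open>g\<close> also has weak
  derivative \<open>g\<close>. Its difference from \<open>h\<close> is orthogonal to all derivatives
  of test functions, hence constant off a null set.\<close>

lemma weak_deriv_imp_antiderivative:
  assumes h: "h absolutely_integrable_on {0..1}" and g: "g absolutely_integrable_on {0..1}"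
    and wd: "weak_deriv h g"
  obtains c N where "negligible N" "\<And>x. x \<in> {0..1} - N \<Longrightarrow> h x = c + integral {0..x} g"
proof -
  define G where "G = (\<lambda>x. integral {0..x} g)"
  have G_cont: "continuous_on {0..1} G"
    unfolding G_def using g by (intro indefinite_integral_continuous_1) (simp add: absolutely_integrable_on_def)
  have G_ai: "G absolutely_integrable_on {0..1}" by (rule absolutely_integrable_continuous_real[OF G_cont])
  have int: "f integrable_on {0..1}" if "f absolutely_integrable_on {0..1}" for f :: "real \<Rightarrow> real"
    using that by (simp add: absolutely_integrable_on_def)
  have orth: "integral {0..1} (\<lambda>x. (h x - G x) * deriv \<phi> x) = 0" if \<phi>: "\<phi> \<in> test_functions" for \<phi>
  proof -
    note T = test_function_products_integrable[OF \<phi>]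
    have "((\<lambda>x. \<phi> x * g x + deriv \<phi> x * G x) has_integral (\<phi> 1 * G 1 - \<phi> 0 * G 0)) {0..1}"
    proof (rule integration_by_parts_indefinite)
      show "(\<phi> has_real_derivative deriv \<phi> x) (at x within {0..1})" for x
        by (rule has_field_derivative_at_within[OF test_functionD(1)[OF \<phi>]])
      show "continuous_on {0..1} (deriv \<phi>)" by (rule test_function_continuous(2)[OF \<phi>])
    qed (use g in \<open>auto simp: G_def\<close>)
    then have "integral {0..1} (\<lambda>x. g x * \<phi> x + G x * deriv \<phi> x) = 0"
      using test_functionD(3,4)[OF \<phi>] by (simp add: has_integral_iff mult.commute)
    then have "integral {0..1} (\<lambda>x. g x * \<phi> x) + integral {0..1} (\<lambda>x. G x * deriv \<phi> x) = 0"
      using integral_add[OF int[OF T(1)[OF g]] int[OF T(2)[OF G_ai]]] by simp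
    moreover have "integral {0..1} (\<lambda>x. h x * deriv \<phi> x) = - integral {0..1} (\<lambda>x. g x * \<phi> x)"
      using wd weak_deriv_iff[OF h g] \<phi> by blast
    ultimately show ?thesis
      using integral_diff[OF int[OF T(2)[OF h]] int[OF T(2)[OF G_ai]]] by (simp add: left_diff_distrib)
  qed
  show thesis
  proof (rule du_Bois_Reymond[OF set_integral_diff(1)[OF h G_ai] orth])
    fix c N assume N: "negligible N" and eq: "\<And>x. x \<in> {0..1} - N \<Longrightarrow> h x - G x = c"
    show thesis
    proof (rule that[OF N])
      show "h x = c + integral {0..x} g" if "x \<in> {0..1} - N" for x
        using eq[OF that] by (simp add: G_def)
    qed
  qed
qed

lemma continuous_eq_off_negligible:
  fixes f g :: "real \<Rightarrow> real"
  assumes "continuous_on {a..b} f" "continuous_on {a..b} g" "a < b" "negligible N"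
    and eq: "\<And>x. x \<in> {a..b} - N \<Longrightarrow> f x = g x" and x: "x \<in> {a..b}"
  shows "f x = g x"
proof -
  have cont: "continuous_on {a..b} (\<lambda>x. \<bar>f x - g x\<bar>)" by (intro continuous_intros assms)
  have "integral {a..b} (\<lambda>x. \<bar>f x - g x\<bar>) = integral {a..b} (\<lambda>x. 0)"
    by (rule integral_spike[OF \<open>negligible N\<close>]) (use eq in auto)
  then have "\<forall>x\<in>{a..b}. \<bar>f x - g x\<bar> = 0"
    using integral_eq_0_iff[OF cont \<open>a < b\<close>] by simp
  then show ?thesis using x by auto
qed

lemma H1_continuous_representation:
  assumes h: "h \<in> H1" and cont: "continuous_on {0..1} h" and x: "x \<in> {0..1}"
  shows "h x = h 0 + integral {0..x} (wderiv h)"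
proof -
  note g = L2_absolutely_integrable(1)[OF H1_wderiv(2)[OF h]]
  obtain c N where N: "negligible N" "\<And>x. x \<in> {0..1} - N \<Longrightarrow> h x = c + integral {0..x} (wderiv h)"
    using weak_deriv_imp_antiderivative[OF L2_absolutely_integrable(1)[OF H1_wderiv(1)[OF h]] g
        H1_wderiv(3)[OF h]] by metis
  have G_cont: "continuous_on {0..1} (\<lambda>x. c + integral {0..x} (wderiv h))"
    using g by (intro continuous_intros indefinite_integral_continuous_1)
      (simp add: absolutely_integrable_on_def)
  have "h x = c + integral {0..x} (wderiv h)" if "x \<in> {0..1}" for x
    by (rule continuous_eq_off_negligible[OF cont G_cont _ N(1) N(2) that]) auto
  from this[OF x] this[of 0] show ?thesis by simp
qed

text \<open>The Sobolev embedding in one dimension: the value at \<open>x\<close> differs from the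
  value at any \<open>y\<close> by at most the integral of the absolute weak derivative, and
  averaging over \<open>y\<close> replaces the value at \<open>y\<close> by an L^1 norm, which the
  L^2 norm dominates.\<close>

lemma H1_sup_bound:
  assumes h: "h \<in> H1" and cont: "continuous_on {0..1} h" and x: "x \<in> {0..1}"
  shows "\<bar>h x\<bar> \<le> L2_norm h + L2_norm (wderiv h)"
proof -
  let ?g = "wderiv h"
  have g: "?g absolutely_integrable_on {0..1}" and gL: "integral {0..1} (\<lambda>x. \<bar>?g x\<bar>) \<le> L2_norm ?g"
    using L2_absolutely_integrable[OF H1_wderiv(2)[OF h]] by auto
  have g_int: "?g integrable_on {0..1}" "(\<lambda>x. \<bar>?g x\<bar>) integrable_on {0..1}"
    using g by (auto simp: absolutely_integrable_on_def)
  have diff: "\<bar>h y - h z\<bar> \<le> integral {0..1} (\<lambda>x. \<bar>?g x\<bar>)" if yz: "0 \<le> z" "z \<le> y" "y \<le> 1" for y z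
  proof -
    have sub: "?g integrable_on {z..y}" "(\<lambda>x. \<bar>?g x\<bar>) integrable_on {z..y}" "?g integrable_on {0..y}"
      using integrable_on_subinterval[OF g_int(1), of z y] integrable_on_subinterval[OF g_int(2), of z y]
        integrable_on_subinterval[OF g_int(1), of 0 y] yz by auto
    have "h y - h z = integral {z..y} ?g"
      using H1_continuous_representation[OF h cont, of y] H1_continuous_representation[OF h cont, of z] yz
        Henstock_Kurzweil_Integration.integral_combine[OF yz(1,2) sub(3)] by simp
    also have "\<bar>\<dots>\<bar> \<le> integral {z..y} (\<lambda>x. \<bar>?g x\<bar>)"
      using integral_norm_bound_integral[OF sub(1,2)] by simp
    also have "\<dots> \<le> integral {0..1} (\<lambda>x. \<bar>?g x\<bar>)"
      using yz by (intro integral_subset_le sub(2) g_int(2)) auto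
    finally show ?thesis .
  qed
  have h_int: "(\<lambda>y. \<bar>h y\<bar>) integrable_on {0..1}"
    by (intro integrable_continuous_real continuous_intros cont)
  have "\<bar>h x\<bar> = integral {0..1} (\<lambda>y::real. \<bar>h x\<bar>)" by simp
  also have "\<dots> \<le> integral {0..1} (\<lambda>y. \<bar>h y\<bar> + integral {0..1} (\<lambda>x. \<bar>?g x\<bar>))"
  proof (rule integral_le)
    show "(\<lambda>y. \<bar>h y\<bar> + integral {0..1} (\<lambda>x. \<bar>?g x\<bar>)) integrable_on {0..1}"
      by (intro integrable_add h_int integrable_const_ivl)
    show "\<bar>h x\<bar> \<le> \<bar>h y\<bar> + integral {0..1} (\<lambda>x. \<bar>?g x\<bar>)" if "y \<in> {0..1}" for y
    proof (cases "x \<le> y")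
      case True
      then show ?thesis using diff[of x y] x that by simp
    next
      case False
      then show ?thesis using diff[of y x] x that by simp
    qed
  qed (rule integrable_const_ivl)
  also have "\<dots> = integral {0..1} (\<lambda>y. \<bar>h y\<bar>) + integral {0..1} (\<lambda>x. \<bar>?g x\<bar>)"
    by (subst integral_add[OF h_int integrable_const_ivl]) simp
  also have "\<dots> \<le> L2_norm h + L2_norm ?g"
    by (intro add_mono gL L2_absolutely_integrable(2)[OF H1_wderiv(1)[OF h]])
  finally show ?thesis .
qed

lemma H1_sup_bound_H2_norm:
  assumes "h \<in> H1" "continuous_on {0..1} h" "x \<in> {0..1}"
  shows "\<bar>h x\<bar> \<le> 2 * H2_norm h"
proof -
  have "L2_norm h \<le> H2_norm h" "L2_norm (wderiv h) \<le> H2_norm h"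
    unfolding H2_norm_def by (auto intro!: real_le_rsqrt)
  then show ?thesis using H1_sup_bound[OF assms] by linarith
qed

text \<open>The representative picked by \<open>wderiv\<close> agrees off a null set with a
  continuous function \<open>p\<close>. Integrals do not see the difference, so \<open>h\<close> is
  a primitive of \<open>p\<close> and the classical fundamental theorem gives the derivative at
  every point, one-sided at the ends.\<close>

lemma H2_continuous_representation:
  assumes h: "h \<in> H2" and cont: "continuous_on {0..1} h"
  obtains p where "continuous_on {0..1} p"
    "\<And>x. x \<in> {0..1} \<Longrightarrow> (h has_real_derivative p x) (at x within {0..1})"
    "\<And>x. x \<in> {0..1} \<Longrightarrow> (wderiv (wderiv h) has_integral (p x - p 0)) {0..x}"
proof -
  have H1: "h \<in> H1" "wderiv h \<in> H1" using h by (auto simp: H2_def)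
  let ?g = "wderiv (wderiv h)"
  note g = L2_absolutely_integrable(1)[OF H1_wderiv(2)[OF H1(2)]]
  have g_int: "?g integrable_on {0..1}" using g by (simp add: absolutely_integrable_on_def)
  obtain c N where N: "negligible N" "\<And>x. x \<in> {0..1} - N \<Longrightarrow> wderiv h x = c + integral {0..x} ?g"
    using weak_deriv_imp_antiderivative[OF L2_absolutely_integrable(1)[OF H1_wderiv(1)[OF H1(2)]] g
        H1_wderiv(3)[OF H1(2)]] by metis
  define p where "p = (\<lambda>x. c + integral {0..x} ?g)"
  have p_cont: "continuous_on {0..1} p"
    unfolding p_def by (intro continuous_intros indefinite_integral_continuous_1 g_int)
  have eq: "h x = h 0 + integral {0..x} p" if "x \<in> {0..1}" for x
  proof -
    have "integral {0..x} (wderiv h) = integral {0..x} p"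
      by (rule integral_spike[OF N(1)]) (use N(2) that in \<open>auto simp: p_def\<close>)
    then show ?thesis using H1_continuous_representation[OF H1(1) cont that] by simp
  qed
  show thesis
  proof (rule that[OF p_cont])
    fix x :: real assume x: "x \<in> {0..1}"
    have "((\<lambda>x. h 0 + integral {0..x} p) has_real_derivative p x) (at x within {0..1})"
      using integral_has_real_derivative[OF p_cont x] by (auto intro!: derivative_eq_intros)
    then show "(h has_real_derivative p x) (at x within {0..1})"
      by (rule has_field_derivative_transform_within[where d = 1]) (use x eq[symmetric] in simp_all)
    have "?g integrable_on {0..x}" using integrable_on_subinterval[OF g_int, of 0 x] x by auto
    then show "(?g has_integral (p x - p 0)) {0..x}" by (simp add: p_def has_integral_iff)
  qed
qed

subsection \<open>The maximum principle\<close>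

text \<open>Tilt the function downwards slightly and take a maximiser. Were it to the right of
  \<open>a\<close>, the tilted function would exceed its maximum just before it. Left slopes suit
  the application, where convexity bounds the increment up to time \<open>t\<close> by a tangent at
  \<open>t\<close>.\<close>

lemma left_slopes_nonpos_imp_le:
  fixes \<phi> :: "real \<Rightarrow> real"
  assumes "a \<le> b" and cont: "continuous_on {a..b} \<phi>"
    and slope: "\<And>t e. t \<in> {a<..b} \<Longrightarrow> e > 0 \<Longrightarrow>
      eventually (\<lambda>s. \<phi> t - \<phi> s \<le> e * (t - s)) (at_left t)"
  shows "\<phi> b \<le> \<phi> a"
proof (rule field_le_epsilon)
  fix e :: real assume e: "e > 0"
  \<comment> \<open>The tilt \<open>2 * c\<close> is twice the slope \<open>c\<close> allowed below,
    which makes the contradiction strict; the \<open>+ 1\<close> keeps the denominator positive when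
    \<open>a = b\<close>.\<close>
  define c where "c = e / (2 * (b - a + 1))"
  have c: "c > 0" "2 * c * (b - a) \<le> e"
    using e \<open>a \<le> b\<close> by (auto simp: c_def field_simps)
  define \<rho> where "\<rho> = (\<lambda>t. \<phi> t - 2 * c * t)"
  have "continuous_on {a..b} \<rho>" unfolding \<rho>_def by (intro continuous_intros cont)
  then obtain t where t: "t \<in> {a..b}" "\<And>s. s \<in> {a..b} \<Longrightarrow> \<rho> s \<le> \<rho> t"
    using continuous_attains_sup[of "{a..b}" \<rho>] \<open>a \<le> b\<close> by auto
  have "t = a"
  proof (rule ccontr)
    assume "t \<noteq> a"
    then have ta: "t \<in> {a<..b}" using t by auto
    have "eventually (\<lambda>s. \<phi> t - \<phi> s \<le> c * (t - s)) (at_left t)"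
      by (rule slope[OF ta c(1)])
    moreover have "eventually (\<lambda>s. s \<in> {a<..<t}) (at_left t)"
      using ta by (intro eventually_at_left_real) auto
    ultimately have "eventually (\<lambda>s. \<phi> t - \<phi> s \<le> c * (t - s) \<and> s \<in> {a<..<t}) (at_left t)"
      by eventually_elim simp
    then obtain s where s: "\<phi> t - \<phi> s \<le> c * (t - s)" "s \<in> {a<..<t}"
      using eventually_happens'[OF trivial_limit_at_left_real] by blast
    have "\<rho> s \<le> \<rho> t" using t s ta by auto
    then have "2 * c * (t - s) \<le> c * (t - s)" using s unfolding \<rho>_def by (simp add: algebra_simps)
    then show False using s c mult_pos_pos[of c "t - s"] by auto
  qed
  then have "\<rho> b \<le> \<rho> a" using t(2)[of b] \<open>a \<le> b\<close> by auto
  then show "\<phi> b \<le> \<phi> a + e" using c unfolding \<rho>_def by (simp add: algebra_simps)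
qed

text \<open>The regularity of a classical solution that the maximum principle uses: \<open>p\<close> is \<open>w\<^sub>x\<close>,
  \<open>w'\<close> is \<open>w\<^sub>t\<close>, and the equation is integrated once in \<open>x\<close>.\<close>

definition regular_solution ::
  "real \<Rightarrow> real \<Rightarrow> (real \<Rightarrow> real \<Rightarrow> real) \<Rightarrow> (real \<Rightarrow> real \<Rightarrow> real) \<Rightarrow> (real \<Rightarrow> real \<Rightarrow> real) \<Rightarrow>
   (real \<Rightarrow> real \<Rightarrow> real) \<Rightarrow> bool" where
  "regular_solution \<alpha> lam f w p w' \<longleftrightarrow>
     continuous_on ({0..1} \<times> {0..}) (\<lambda>(x, t). w x t) \<and>
     (\<forall>t\<ge>0. continuous_on {0..1} (\<lambda>x. p x t)) \<and>
     (\<forall>t\<ge>0. \<forall>x\<in>{0..1}. ((\<lambda>x. w x t) has_real_derivative p x t) (at x within {0..1})) \<and>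
     (\<forall>t>0. (\<lambda>x. w' x t) absolutely_integrable_on {0..1} \<and>
            (\<lambda>x. f x t) absolutely_integrable_on {0..1} \<and>
            ((\<lambda>s. integral {0..1} (\<lambda>x. \<bar>(w x s - w x t) / (s - t) - w' x t\<bar>)) \<longlongrightarrow> 0)
              (at t within {0..}) \<and>
            (\<forall>x\<in>{0..1}. ((\<lambda>y. w' y t + lam * w y t - f y t) has_integral \<alpha> * (p x t - p 0 t)) {0..x}))"

lemma regular_solutionD:
  assumes "regular_solution \<alpha> lam f w p w'"
  shows "continuous_on ({0..1} \<times> {0..}) (\<lambda>(x, t). w x t)"
    and "t \<ge> 0 \<Longrightarrow> continuous_on {0..1} (\<lambda>x. p x t)"
    and "t \<ge> 0 \<Longrightarrow> x \<in> {0..1} \<Longrightarrow> ((\<lambda>x. w x t) has_real_derivative p x t) (at x within {0..1})"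
    and "t > 0 \<Longrightarrow> (\<lambda>x. w' x t) absolutely_integrable_on {0..1}"
    and "t > 0 \<Longrightarrow> (\<lambda>x. f x t) absolutely_integrable_on {0..1}"
    and "t > 0 \<Longrightarrow> ((\<lambda>s. integral {0..1} (\<lambda>x. \<bar>(w x s - w x t) / (s - t) - w' x t\<bar>)) \<longlongrightarrow> 0)
              (at t within {0..})"
    and "t > 0 \<Longrightarrow> x \<in> {0..1} \<Longrightarrow>
      ((\<lambda>y. w' y t + lam * w y t - f y t) has_integral \<alpha> * (p x t - p 0 t)) {0..x}"
  using assms by (simp_all add: regular_solution_def)

lemma regular_solution_cont_x:
  assumes "regular_solution \<alpha> lam f w p w'" "t \<ge> 0"
  shows "continuous_on {0..1} (\<lambda>x. w x t)"
  by (rule DERIV_continuous_on) (rule regular_solutionD(3)[OF assms])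

lemma regular_solution_slope_integrable:
  assumes "regular_solution \<alpha> lam f w p w'" "t > 0" "s \<ge> 0"
  shows "(\<lambda>x. (w x s - w x t) / (s - t) - w' x t) absolutely_integrable_on {0..1}"
proof (rule set_integral_diff(1))
  show "(\<lambda>x. (w x s - w x t) / (s - t)) absolutely_integrable_on {0..1}"
    \<comment> \<open>Multiplying by the inverse also covers \<open>s = t\<close>, where
      \<open>inverse 0 = 0\<close> makes the quotient vanish.\<close>
    unfolding divide_inverse
    using assms(2,3)
    by (intro absolutely_integrable_continuous_real continuous_on_mult continuous_on_diff
        continuous_on_const regular_solution_cont_x[OF assms(1)]) auto
qed (rule regular_solutionD(4)[OF assms(1,2)])

text \<open>Superposition. All clauses are linear except the L^1 limit of the time quotients, which
  the triangle inequality squeezes to zero.\<close>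

lemma regular_solution_diff:
  assumes "regular_solution \<alpha> lam f1 w1 p1 w1'" "regular_solution \<alpha> lam f2 w2 p2 w2'"
  shows "regular_solution \<alpha> lam (\<lambda>x t. f1 x t - f2 x t) (\<lambda>x t. w1 x t - w2 x t)
           (\<lambda>x t. p1 x t - p2 x t) (\<lambda>x t. w1' x t - w2' x t)"
  unfolding regular_solution_def
proof (intro conjI allI impI ballI)
  note D1 = regular_solutionD[OF assms(1)] and D2 = regular_solutionD[OF assms(2)]
  show "continuous_on ({0..1} \<times> {0..}) (\<lambda>(x, t). w1 x t - w2 x t)"
    using continuous_on_diff[OF D1(1) D2(1)] by (simp add: case_prod_beta)
  show "continuous_on {0..1} (\<lambda>x. p1 x t - p2 x t)" if "t \<ge> 0" for t
    by (rule continuous_on_diff[OF D1(2) D2(2)]) fact+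
  show "((\<lambda>x. w1 x t - w2 x t) has_real_derivative p1 x t - p2 x t) (at x within {0..1})"
    if "t \<ge> 0" "x \<in> {0..1}" for t x
    by (rule DERIV_diff[OF D1(3) D2(3)]) fact+
  fix t :: real assume t: "t > 0"
  show "(\<lambda>x. w1' x t - w2' x t) absolutely_integrable_on {0..1}"
    by (rule set_integral_diff(1)[OF D1(4) D2(4)]) fact+
  show "(\<lambda>x. f1 x t - f2 x t) absolutely_integrable_on {0..1}"
    by (rule set_integral_diff(1)[OF D1(5) D2(5)]) fact+
  show "((\<lambda>y. w1' y t - w2' y t + lam * (w1 y t - w2 y t) - (f1 y t - f2 y t)) has_integral
            \<alpha> * (p1 x t - p2 x t - (p1 0 t - p2 0 t))) {0..x}" if x: "x \<in> {0..1}" for x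
  proof -
    have "((\<lambda>y. (w1' y t + lam * w1 y t - f1 y t) - (w2' y t + lam * w2 y t - f2 y t))
            has_integral (\<alpha> * (p1 x t - p1 0 t) - \<alpha> * (p2 x t - p2 0 t))) {0..x}"
      by (rule has_integral_diff[OF D1(7)[OF t x] D2(7)[OF t x]])
    moreover have "(\<lambda>y. (w1' y t + lam * w1 y t - f1 y t) - (w2' y t + lam * w2 y t - f2 y t))
       = (\<lambda>y. w1' y t - w2' y t + lam * (w1 y t - w2 y t) - (f1 y t - f2 y t))"
      by (auto simp: algebra_simps)
    moreover have "\<alpha> * (p1 x t - p1 0 t) - \<alpha> * (p2 x t - p2 0 t)
        = \<alpha> * (p1 x t - p2 x t - (p1 0 t - p2 0 t))" by (simp add: algebra_simps)
    ultimately show ?thesis by simp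
  qed
  define e1 where "e1 = (\<lambda>s x. (w1 x s - w1 x t) / (s - t) - w1' x t)"
  define e2 where "e2 = (\<lambda>s x. (w2 x s - w2 x t) / (s - t) - w2' x t)"
  have l: "((\<lambda>s. integral {0..1} (\<lambda>x. \<bar>e1 s x\<bar>) + integral {0..1} (\<lambda>x. \<bar>e2 s x\<bar>)) \<longlongrightarrow> 0)
            (at t within {0..})"
    using tendsto_add[OF D1(6)[OF t] D2(6)[OF t]] unfolding e1_def e2_def by simp
  have e: "(w1 x s - w2 x s - (w1 x t - w2 x t)) / (s - t) - (w1' x t - w2' x t) = e1 s x - e2 s x" for s x
    unfolding e1_def e2_def by (simp add: diff_divide_distrib)
  have ai: "e1 s absolutely_integrable_on {0..1}" "e2 s absolutely_integrable_on {0..1}" if "s \<ge> 0" for s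
    unfolding e1_def e2_def
    by (rule regular_solution_slope_integrable[OF assms(1) t that]
             regular_solution_slope_integrable[OF assms(2) t that])+
  have "norm (integral {0..1} (\<lambda>x. \<bar>e1 s x - e2 s x\<bar>))
      \<le> integral {0..1} (\<lambda>x. \<bar>e1 s x\<bar>) + integral {0..1} (\<lambda>x. \<bar>e2 s x\<bar>)" if "s \<ge> 0" for s
  proof -
    have n: "(\<lambda>x. \<bar>e1 s x\<bar>) integrable_on {0..1}" "(\<lambda>x. \<bar>e2 s x\<bar>) integrable_on {0..1}"
         "(\<lambda>x. \<bar>e1 s x - e2 s x\<bar>) integrable_on {0..1}"
      using ai[OF that] set_integral_diff(1)[OF ai[OF that]]
      by (auto simp: absolutely_integrable_on_def)
    have "norm (integral {0..1} (\<lambda>x. \<bar>e1 s x - e2 s x\<bar>)) = integral {0..1} (\<lambda>x. \<bar>e1 s x - e2 s x\<bar>)"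
      using integral_nonneg[OF n(3)] by simp
    also have "\<dots> \<le> integral {0..1} (\<lambda>x. \<bar>e1 s x\<bar> + \<bar>e2 s x\<bar>)"
      using n by (intro integral_le integrable_add) auto
    finally show ?thesis using integral_add[OF n(1,2)] by simp
  qed
  then have "eventually (\<lambda>s. norm (integral {0..1} (\<lambda>x. \<bar>e1 s x - e2 s x\<bar>))
      \<le> integral {0..1} (\<lambda>x. \<bar>e1 s x\<bar>) + integral {0..1} (\<lambda>x. \<bar>e2 s x\<bar>)) (at t within {0..})"
    unfolding eventually_at_filter by (intro always_eventually) auto
  then have "((\<lambda>s. integral {0..1} (\<lambda>x. \<bar>e1 s x - e2 s x\<bar>)) \<longlongrightarrow> 0) (at t within {0..})"
    by (rule Lim_null_comparison[OF _ l])
  then show "((\<lambda>s. integral {0..1} (\<lambda>x. \<bar>(w1 x s - w2 x s - (w1 x t - w2 x t)) / (s - t)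
                - (w1' x t - w2' x t)\<bar>)) \<longlongrightarrow> 0) (at t within {0..})"
    unfolding e .
qed

lemma regular_solution_zero: "regular_solution \<alpha> lam (\<lambda>x t. 0) (\<lambda>x t. 0) (\<lambda>x t. 0) (\<lambda>x t. 0)"
  by (auto simp: regular_solution_def)

lemma regular_solution_uminus:
  assumes "regular_solution \<alpha> lam f w p w'"
  shows "regular_solution \<alpha> lam (\<lambda>x t. - f x t) (\<lambda>x t. - w x t) (\<lambda>x t. - p x t) (\<lambda>x t. - w' x t)"
  using regular_solution_diff[OF regular_solution_zero assms] by simp

text \<open>The first-order remainder is at most \<open>(z - y)\<^sup>2\<close> for every
  combination of signs, so the kink of the positive part disappears on squaring.\<close>

lemma DERIV_pos_part_square:
  "((\<lambda>y::real. (max 0 y)\<^sup>2) has_real_derivative 2 * max 0 y) (at y)"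
proof -
  have "((\<lambda>z. ((max 0 z)\<^sup>2 - (max 0 y)\<^sup>2) / (z - y) - 2 * max 0 y) \<longlongrightarrow> 0) (at y)"
  proof (rule Lim_null_comparison)
    show "eventually (\<lambda>z. norm (((max 0 z)\<^sup>2 - (max 0 y)\<^sup>2) / (z - y) - 2 * max 0 y) \<le> \<bar>z - y\<bar>) (at y)"
      unfolding eventually_at_filter
    proof (intro always_eventually allI impI)
      fix z :: real assume "z \<noteq> y"
      have q: "\<bar>(max 0 z)\<^sup>2 - (max 0 y)\<^sup>2 - 2 * max 0 y * (z - y)\<bar> \<le> (z - y)\<^sup>2"
      proof -
        consider "z \<ge> 0" "y \<ge> 0" | "z \<ge> 0" "y < 0" | "z < 0" "y \<ge> 0" | "z < 0" "y < 0" by linarith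
        then show ?thesis
        proof cases
          case 1
          have "z\<^sup>2 - y\<^sup>2 - 2 * y * (z - y) = (z - y)\<^sup>2" by algebra
          then show ?thesis using 1 by simp
        next
          case 2
          have "z * y \<le> 0" using 2 by (simp add: mult_nonneg_nonpos)
          moreover have "(z - y)\<^sup>2 = z\<^sup>2 - 2 * (z * y) + y\<^sup>2" by algebra
          ultimately have "z\<^sup>2 \<le> (z - y)\<^sup>2" using zero_le_power2[of y] by linarith
          then show ?thesis using 2 by simp
        next
          case 3
          have "z * y \<le> 0" using 3 by (simp add: mult_nonpos_nonneg)
          moreover have "0 - y\<^sup>2 - 2 * y * (z - y) = y\<^sup>2 - 2 * (z * y)"
            "(z - y)\<^sup>2 = z\<^sup>2 - 2 * (z * y) + y\<^sup>2" by algebra+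
          ultimately have "\<bar>0 - y\<^sup>2 - 2 * y * (z - y)\<bar> \<le> (z - y)\<^sup>2"
            using zero_le_power2[of y] zero_le_power2[of z] by linarith
          then show ?thesis using 3 by simp
        next
          case 4 then show ?thesis by simp
        qed
      qed
      have eq: "((max 0 z)\<^sup>2 - (max 0 y)\<^sup>2) / (z - y) - 2 * max 0 y
          = ((max 0 z)\<^sup>2 - (max 0 y)\<^sup>2 - 2 * max 0 y * (z - y)) / (z - y)"
        using \<open>z \<noteq> y\<close> by (simp add: diff_divide_distrib)
      have quot: "\<bar>m / d\<bar> \<le> \<bar>d\<bar>" if "\<bar>m\<bar> \<le> d\<^sup>2" "d \<noteq> 0" for m d :: real
      proof -
        have "\<bar>m\<bar> \<le> \<bar>d\<bar> * \<bar>d\<bar>" using that(1) by (simp add: power2_eq_square)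
        then show ?thesis using that(2) by (simp add: abs_divide pos_divide_le_eq)
      qed
      show "norm (((max 0 z)\<^sup>2 - (max 0 y)\<^sup>2) / (z - y) - 2 * max 0 y) \<le> \<bar>z - y\<bar>"
        unfolding eq real_norm_def by (rule quot[OF q]) (use \<open>z \<noteq> y\<close> in simp)
    qed
    have "((\<lambda>z. \<bar>z - y\<bar>) \<longlongrightarrow> \<bar>y - y\<bar>) (at y)" by (intro tendsto_intros)
    then show "((\<lambda>z. \<bar>z - y\<bar>) \<longlongrightarrow> 0) (at y)" by simp
  qed
  then show ?thesis unfolding has_field_derivative_iff by (rule LIM_zero_cancel)
qed

text \<open>Convexity with the tangent taken at \<open>b\<close>: for the positive parts the gap is
  exactly (A - B)^2 (A + 2 B). In the application \<open>b\<close> belongs to the fixed time and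
  \<open>a\<close> to the earlier one, so the slope factor does not move in the limit.\<close>

lemma pos_part_cube_tangent:
  fixes a b :: real
  shows "(max 0 b)^3 - (max 0 a)^3 \<le> 3 * (max 0 b)\<^sup>2 * (b - a)"
proof -
  define A B where "A = max 0 a" and "B = max 0 b"
  have "0 \<le> (A - B)\<^sup>2 * (A + 2 * B)" by (simp add: A_def B_def)
  then have "B^3 - A^3 \<le> 3 * B\<^sup>2 * (B - A)"
    by (simp add: algebra_simps power2_eq_square power3_eq_cube)
  also have "\<dots> \<le> 3 * B\<^sup>2 * (b - a)"
  proof (cases "b \<le> 0")
    case True then show ?thesis by (simp add: B_def)
  next
    case False then show ?thesis by (intro mult_left_mono) (auto simp: A_def B_def)
  qed
  finally show ?thesis unfolding A_def B_def .
qed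

text \<open>Either alternative in \<open>bc0\<close> removes the boundary term at 0: a homogeneous
  Neumann condition annihilates the flux, and a value below the level annihilates the test function.
  The first serves the observer error, the second the tracking error. At 1 only the sign of the flux
  matters, and only where the test function is nonzero.\<close>

lemma maximum_principle:
  assumes sol: "regular_solution \<alpha> lam f w p w'"
    and \<alpha>: "\<alpha> > 0" and \<sigma>: "\<sigma> \<le> lam" "0 \<le> lam" and T: "T > 0"
    and init: "\<And>x. x \<in> {0..1} \<Longrightarrow> w x 0 \<le> M"
    and f: "\<And>x t. x \<in> {0..1} \<Longrightarrow> t \<in> {0<..T} \<Longrightarrow> f x t \<le> (lam - \<sigma>) * (M * exp (- \<sigma> * t))"
    and bc0: "\<And>t. t \<in> {0<..T} \<Longrightarrow> p 0 t = 0 \<or> w 0 t \<le> M * exp (- \<sigma> * t)"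
    and bc1: "\<And>t. t \<in> {0<..T} \<Longrightarrow> w 1 t > M * exp (- \<sigma> * t) \<Longrightarrow> p 1 t \<le> 0"
    and x: "x \<in> {0..1}"
  shows "w x T \<le> M * exp (- \<sigma> * T)"
proof -
  note D = regular_solutionD[OF sol]
  define m where "m = (\<lambda>t. M * exp (- \<sigma> * t))"
  define y where "y = (\<lambda>x t. max 0 (w x t - m t))"
  define \<phi> where "\<phi> = (\<lambda>t. integral {0..1} (\<lambda>x. (y x t)^3))"
  have m_cont: "continuous_on A m" for A unfolding m_def by (intro continuous_intros)
  have y_cont: "continuous_on {0..1} (\<lambda>x. y x t)" if "t \<ge> 0" for t
    unfolding y_def using that by (intro continuous_intros regular_solution_cont_x[OF sol])
  have \<phi>_cont: "continuous_on {0..T} \<phi>"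
  proof -
    have "continuous_on ({0..T} \<times> {0..1}) ((\<lambda>(x, t). w x t) \<circ> (\<lambda>q. (snd q, fst q)))"
      by (intro continuous_on_compose continuous_intros continuous_on_subset[OF D(1)]) auto
    then have w2: "continuous_on ({0..T} \<times> {0..1}) (\<lambda>q. w (snd q) (fst q))" by (simp add: o_def)
    have m2: "continuous_on ({0..T} \<times> {0..1::real}) (\<lambda>q. m (fst q))"
      unfolding m_def by (intro continuous_intros)
    have "continuous_on ({0..T} \<times> {0..1}) (\<lambda>q. (max 0 (w (snd q) (fst q) - m (fst q)))^3)"
      by (intro continuous_intros w2 m2)
    then have "continuous_on ({0..T} \<times> cbox 0 1) (\<lambda>(t, x). (y x t)^3)"
      by (simp add: y_def case_prod_beta)
    then show ?thesis
      unfolding \<phi>_def using integral_continuous_on_param by fastforce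
  qed
  have slope: "eventually (\<lambda>s. \<phi> t - \<phi> s \<le> e * (t - s)) (at_left t)"
    if t: "t \<in> {0<..T}" and e: "e > 0" for t e
  proof -
    have t0: "t > 0" "t \<ge> 0" using t by auto
    \<comment> \<open>\<open>z\<close> is the derivative of the cubed positive part, frozen at time
      \<open>t\<close>, and \<open>z'\<close> is its derivative in x. By the equation
      \<open>g\<close> stands for \<alpha> w_xx, so \<open>P\<close> is a primitive of it.\<close>
    define z where "z = (\<lambda>x. 3 * (y x t)\<^sup>2)"
    define z' where "z' = (\<lambda>x. 6 * y x t * p x t)"
    define g where "g = (\<lambda>x. w' x t + lam * w x t - f x t)"
    define P where "P = (\<lambda>x. \<alpha> * p x t)"
    have z_cont: "continuous_on {0..1} z"
      unfolding z_def using t0 by (intro continuous_intros y_cont)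
    have z_nn: "z x \<ge> 0" for x by (simp add: z_def)
    have w_ai: "(\<lambda>x. lam * w x t) absolutely_integrable_on {0..1}"
      by (intro absolutely_integrable_continuous_real continuous_on_mult_left
          regular_solution_cont_x[OF sol] t0)
    have g_ai: "g absolutely_integrable_on {0..1}"
      unfolding g_def by (intro set_integral_diff(1) set_integral_add(1) w_ai D(4,5) t0)
    have zw_ai: "(\<lambda>x. z x * w' x t) absolutely_integrable_on {0..1}"
      by (rule absolutely_integrable_continuous_mult[OF z_cont D(4)[OF t0(1)]])
    have z_int: "z integrable_on {0..1}" by (rule integrable_continuous_real[OF z_cont])
    have zw_int: "(\<lambda>x. z x * w' x t) integrable_on {0..1}"
      using zw_ai by (simp add: absolutely_integrable_on_def)
    \<comment> \<open>Since m' = - \<sigma> m, this integral is formally the derivative of \<phi> at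
      \<open>t\<close>. Integration by parts turns the diffusion into boundary terms of the right
      sign minus the nonnegative integral of \<open>z' x * P x\<close>.\<close>
    have decay: "integral {0..1} (\<lambda>x. z x * w' x t + \<sigma> * m t * z x) \<le> 0"
    proof -
      have ibp: "((\<lambda>x. z x * g x + z' x * P x) has_integral (z 1 * P 1 - z 0 * P 0)) {0..1}"
      proof (rule integration_by_parts_indefinite)
        show "P x = P 0 + integral {0..x} g" if "x \<in> {0..1}" for x
          using D(7)[OF t0(1) that] unfolding P_def g_def
          by (simp add: has_integral_iff right_diff_distrib)
        show "(z has_real_derivative z' x) (at x within {0..1})" if "x \<in> {0..1}" for x
        proof -
          have "((\<lambda>x. w x t - m t) has_real_derivative p x t) (at x within {0..1})"
            using D(3)[OF t0(2) that] by (auto intro!: derivative_eq_intros)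
          from DERIV_chain2[OF DERIV_pos_part_square this]
          have "((\<lambda>x. (y x t)\<^sup>2) has_real_derivative 2 * y x t * p x t) (at x within {0..1})"
            by (simp add: y_def)
          from DERIV_cmult[OF this, of 3] show ?thesis
            unfolding z_def z'_def by (simp add: mult_ac)
        qed
        show "continuous_on {0..1} z'"
          unfolding z'_def using t0 by (intro continuous_intros y_cont D(2))
      qed (use g_ai in auto)
      have "integral {0..1} (\<lambda>x. z x * w' x t + \<sigma> * m t * z x)
          \<le> integral {0..1} (\<lambda>x. z x * g x + z' x * P x)"
      proof (rule integral_le)
        show "(\<lambda>x. z x * w' x t + \<sigma> * m t * z x) integrable_on {0..1}"
          by (intro integrable_add zw_int integrable_on_mult_right z_int)
        show "(\<lambda>x. z x * g x + z' x * P x) integrable_on {0..1}"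
          using ibp by blast
        fix x :: real assume x: "x \<in> {0..1}"
        have "0 \<le> z' x * P x"
        proof -
          have "z' x * P x = 6 * \<alpha> * y x t * (p x t)\<^sup>2"
            by (simp add: z'_def P_def power2_eq_square)
          then show ?thesis using \<alpha> by (simp add: y_def)
        qed
        \<comment> \<open>Only points with w > m count, since \<open>z\<close> vanishes elsewhere.
          There lam w is at least lam m, and the bound on \<open>f\<close> leaves a nonnegative
          remainder.\<close>
        moreover have "0 \<le> z x * (lam * w x t - f x t - \<sigma> * m t)"
        proof (cases "w x t \<le> m t")
          case True then show ?thesis by (simp add: z_def y_def)
        next
          case False
          have "f x t \<le> (lam - \<sigma>) * m t" unfolding m_def by (rule f[OF x t])
          moreover have "lam * m t \<le> lam * w x t" using False \<sigma> by (intro mult_left_mono) auto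
          ultimately have "0 \<le> lam * w x t - f x t - \<sigma> * m t" by (simp add: left_diff_distrib)
          then show ?thesis using z_nn by (rule mult_nonneg_nonneg[rotated])
        qed
        ultimately show "z x * w' x t + \<sigma> * m t * z x \<le> z x * g x + z' x * P x"
          unfolding g_def by (simp add: algebra_simps)
      qed
      also have "\<dots> = z 1 * P 1 - z 0 * P 0" using ibp by (rule integral_unique)
      also have "\<dots> \<le> 0"
      proof -
        have "z 0 * P 0 = 0"
          using bc0[OF t] unfolding z_def y_def P_def m_def by auto
        moreover have "z 1 * P 1 \<le> 0"
        proof (cases "w 1 t \<le> m t")
          case True then show ?thesis by (simp add: z_def y_def)
        next
          case False
          then have "p 1 t \<le> 0" using bc1[OF t] by (simp add: m_def)
          then show ?thesis unfolding P_def using \<alpha> z_nn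
            by (intro mult_nonneg_nonpos) (auto simp: mult_nonneg_nonpos)
        qed
        ultimately show ?thesis by linarith
      qed
      finally show ?thesis .
    qed
    obtain K where K: "K > 0" "\<And>x. x \<in> {0..1} \<Longrightarrow> z x \<le> K"
    proof -
      have "bounded (z ` {0..1})"
        using z_cont compact_continuous_image compact_imp_bounded by blast
      then obtain K where "\<forall>y \<in> z ` {0..1}. \<bar>y\<bar> \<le> K" by (auto simp: bounded_iff)
      then have "\<And>x. x \<in> {0..1} \<Longrightarrow> z x \<le> max K 1" by force
      then show thesis using that[of "max K 1"] by auto
    qed
    define E where "E = (\<lambda>s. integral {0..1} (\<lambda>x. \<bar>(w x s - w x t) / (s - t) - w' x t\<bar>))"
    define F where "F = (\<lambda>s. \<bar>(m s - m t) / (s - t) + \<sigma> * m t\<bar>)"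
    have E_lim: "(E \<longlongrightarrow> 0) (at_left t)"
    proof -
      have "(E \<longlongrightarrow> 0) (at t within {0..})" unfolding E_def by (rule D(6)[OF t0(1)])
      then have "(E \<longlongrightarrow> 0) (at t within {0..<t})" by (rule tendsto_within_subset) auto
      moreover have "at t within {0..<t} = at_left t"
        using t0 by (intro at_within_nhd[of _ "{0<..}"]) auto
      ultimately show ?thesis by simp
    qed
    have F_lim: "(F \<longlongrightarrow> 0) (at_left t)"
    proof -
      have "(m has_real_derivative - \<sigma> * m t) (at t)"
        unfolding m_def by (auto intro!: derivative_eq_intros)
      then have "((\<lambda>s. (m s - m t) / (s - t)) \<longlongrightarrow> - \<sigma> * m t) (at_left t)"
        unfolding has_field_derivative_iff by (rule tendsto_within_subset) auto
      then have "(F \<longlongrightarrow> \<bar>- \<sigma> * m t + \<sigma> * m t\<bar>) (at_left t)"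
        unfolding F_def by (intro tendsto_intros)
      then show ?thesis by simp
    qed
    have "((\<lambda>s. K * (E s + F s)) \<longlongrightarrow> K * (0 + 0)) (at_left t)"
      by (intro tendsto_intros E_lim F_lim)
    then have "eventually (\<lambda>s. K * (E s + F s) < e) (at_left t)"
      using e by (intro order_tendstoD(2)) auto
    moreover have "eventually (\<lambda>s. s \<in> {0<..<t}) (at_left t)"
      using t0 by (intro eventually_at_left_real) auto
    ultimately show ?thesis
    proof eventually_elim
      case (elim s)
      then have s: "0 < s" "s < t" "s \<ge> 0" by auto
      \<comment> \<open>\<open>c\<close> and \<open>d\<close> are the defects of the two time
        quotients. They split the tangent bound on the increment of \<phi> into the integral treated
        in \<open>decay\<close> and an error controlled by \<open>K * (E s + F s)\<close>.\<close>
      define c where "c = (m s - m t) / (s - t) + \<sigma> * m t"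
      define d where "d = (\<lambda>x. (w x s - w x t) / (s - t) - w' x t)"
      have d_ai: "d absolutely_integrable_on {0..1}"
        unfolding d_def by (rule regular_solution_slope_integrable[OF sol t0(1) s(3)])
      have zd_int: "(\<lambda>x. z x * d x) integrable_on {0..1}"
        using absolutely_integrable_continuous_mult[OF z_cont d_ai]
        by (simp add: absolutely_integrable_on_def)
      have d_int: "(\<lambda>x. \<bar>d x\<bar>) integrable_on {0..1}"
        using d_ai by (simp add: absolutely_integrable_on_def)
      have y3: "(\<lambda>x. (y x r)^3) integrable_on {0..1}" if "r \<ge> 0" for r
        using that by (intro integrable_continuous_real continuous_intros y_cont)
      have "\<phi> t - \<phi> s = integral {0..1} (\<lambda>x. (y x t)^3 - (y x s)^3)"
        unfolding \<phi>_def using y3 t0 s by (simp add: integral_diff)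
      also have "\<dots> \<le> integral {0..1} (\<lambda>x. (t - s) * ((z x * w' x t + \<sigma> * m t * z x) + (z x * d x - c * z x)))"
      proof (rule integral_le)
        show "(\<lambda>x. (y x t)^3 - (y x s)^3) integrable_on {0..1}"
          using y3 t0 s by (intro integrable_diff) auto
        show "(\<lambda>x. (t - s) * ((z x * w' x t + \<sigma> * m t * z x) + (z x * d x - c * z x))) integrable_on {0..1}"
          by (intro integrable_on_mult_right integrable_add integrable_diff zw_int zd_int z_int)
        fix x :: real
        have "(y x t)^3 - (y x s)^3 \<le> 3 * (y x t)\<^sup>2 * ((w x t - m t) - (w x s - m s))"
          unfolding y_def by (rule pos_part_cube_tangent)
        also have "\<dots> = z x * ((w x t - w x s) - (m t - m s))" by (simp add: z_def)
        also have "w x t - w x s = (t - s) * (w' x t + d x)"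
          using s unfolding d_def by (simp add: field_simps)
        also have "m t - m s = (t - s) * (c - \<sigma> * m t)"
          using s unfolding c_def by (simp add: field_simps)
        also have "z x * ((t - s) * (w' x t + d x) - (t - s) * (c - \<sigma> * m t))
          = (t - s) * ((z x * w' x t + \<sigma> * m t * z x) + (z x * d x - c * z x))" by algebra
        finally show "(y x t)^3 - (y x s)^3
            \<le> (t - s) * ((z x * w' x t + \<sigma> * m t * z x) + (z x * d x - c * z x))" .
      qed
      also have "\<dots> = (t - s) * (integral {0..1} (\<lambda>x. z x * w' x t + \<sigma> * m t * z x)
           + integral {0..1} (\<lambda>x. z x * d x - c * z x))"
        by (simp only: integral_mult_right,
            subst integral_add) (intro integrable_on_mult_right integrable_add integrable_diff zw_int zd_int z_int refl)+
      also have "\<dots> \<le> (t - s) * (0 + K * (E s + F s))"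
      proof (intro mult_left_mono add_mono decay)
        have "integral {0..1} (\<lambda>x. z x * d x - c * z x) \<le> integral {0..1} (\<lambda>x. K * \<bar>d x\<bar> + K * \<bar>c\<bar>)"
        proof (rule integral_le)
          show "(\<lambda>x. z x * d x - c * z x) integrable_on {0..1}"
            by (intro integrable_on_mult_right integrable_diff zd_int z_int)
          show "(\<lambda>x. K * \<bar>d x\<bar> + K * \<bar>c\<bar>) integrable_on {0..1}"
            by (intro integrable_add integrable_on_mult_right d_int integrable_const_ivl)
          fix x :: real assume "x \<in> {0..1}"
          then have "z x * r \<le> K * \<bar>r\<bar>" for r
            using mult_mono[OF K(2) abs_ge_self[of r]] z_nn K(1)
              mult_left_mono[OF abs_ge_self[of r] z_nn[of x]] mult_right_mono[OF K(2), of x "\<bar>r\<bar>"]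
            by (meson abs_ge_zero order_trans)
          from this[of "d x"] this[of "- c"]
          show "z x * d x - c * z x \<le> K * \<bar>d x\<bar> + K * \<bar>c\<bar>" by (simp add: mult.commute)
        qed
        also have "\<dots> = K * (E s + F s)"
          using integral_add[OF integrable_on_mult_right[OF d_int, of K] integrable_const_ivl[of "K * \<bar>c\<bar>" 0 1]]
          unfolding E_def F_def d_def c_def by (simp add: distrib_left)
        finally show "integral {0..1} (\<lambda>x. z x * d x - c * z x) \<le> K * (E s + F s)" .
      qed (use s in auto)
      also have "\<dots> \<le> (t - s) * e" using elim(1) s by (intro mult_left_mono) auto
      finally show ?case by (simp add: mult.commute)
    qed
  qed
  have "\<phi> T \<le> \<phi> 0"
    by (rule left_slopes_nonpos_imp_le[OF _ \<phi>_cont slope]) (use T in auto)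
  also have "\<phi> 0 = integral {0..1} (\<lambda>x::real. 0::real)"
    unfolding \<phi>_def by (rule integral_cong) (use init in \<open>auto simp: y_def m_def\<close>)
  finally have "\<phi> T \<le> 0" by simp
  moreover have c3: "continuous_on {0..1} (\<lambda>x. (y x T)^3)"
    using T by (intro continuous_intros y_cont) auto
  moreover have "\<phi> T \<ge> 0"
    unfolding \<phi>_def by (intro integral_nonneg integrable_continuous_real c3) (simp add: y_def)
  ultimately have "\<forall>x\<in>{0..1}. (y x T)^3 = 0"
    using integral_eq_0_iff[OF c3] by (simp add: \<phi>_def y_def)
  then have "y x T = 0" using x by auto
  then show ?thesis using max.cobounded2[of "w x T - m T" 0] by (simp add: y_def m_def)
qed

text \<open>The one-sided principle is applied to w and to -w. The Robin condition supplies the sign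
  at 1: once w(1,t) exceeds the level, l w(1,t) exceeds the bound on \<open>b\<close>, and the flux
  is nonpositive. Here T = 0 is allowed, so the estimate covers the initial time as well.\<close>

lemma maximum_principle_abs:
  assumes sol: "regular_solution \<alpha> lam f w p w'"
    and \<alpha>: "\<alpha> > 0" and \<sigma>: "\<sigma> \<le> lam" "0 \<le> lam" and T: "T \<ge> 0"
    and init: "\<And>x. x \<in> {0..1} \<Longrightarrow> \<bar>w x 0\<bar> \<le> M"
    and f: "\<And>x t. x \<in> {0..1} \<Longrightarrow> t \<in> {0<..T} \<Longrightarrow> \<bar>f x t\<bar> \<le> (lam - \<sigma>) * (M * exp (- \<sigma> * t))"
    and bc0: "\<And>t. t \<in> {0<..T} \<Longrightarrow> p 0 t = 0 \<or> \<bar>w 0 t\<bar> \<le> M * exp (- \<sigma> * t)"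
    and bc1: "\<And>t. t \<in> {0<..T} \<Longrightarrow> p 1 t = - l * w 1 t + b t"
    and l: "l > 0" and b: "\<And>t. t \<in> {0<..T} \<Longrightarrow> \<bar>b t\<bar> \<le> l * (M * exp (- \<sigma> * t))"
    and x: "x \<in> {0..1}"
  shows "\<bar>w x T\<bar> \<le> M * exp (- \<sigma> * T)"
proof (cases "T = 0")
  case True then show ?thesis using init[OF x] by simp
next
  case False
  then have T': "T > 0" using T by simp
  have robin: "p 1 t \<le> 0" if t: "t \<in> {0<..T}" and w: "w 1 t > M * exp (- \<sigma> * t)" for t
    using mult_strict_left_mono[OF w l] b[OF t] bc1[OF t] by simp
  have robin': "- p 1 t \<le> 0" if t: "t \<in> {0<..T}" and w: "- w 1 t > M * exp (- \<sigma> * t)" for t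
    using mult_strict_left_mono[OF w l] b[OF t] bc1[OF t] by simp
  have "w x T \<le> M * exp (- \<sigma> * T)"
  proof (rule maximum_principle[OF sol \<alpha> \<sigma> T' _ _ _ robin x])
    show "w x 0 \<le> M" if "x \<in> {0..1}" for x using init[OF that] by simp
    show "f x t \<le> (lam - \<sigma>) * (M * exp (- \<sigma> * t))" if "x \<in> {0..1}" "t \<in> {0<..T}" for x t
      using f[OF that] by linarith
    show "p 0 t = 0 \<or> w 0 t \<le> M * exp (- \<sigma> * t)" if "t \<in> {0<..T}" for t
      using bc0[OF that] by linarith
  qed auto
  moreover have "- w x T \<le> M * exp (- \<sigma> * T)"
  proof (rule maximum_principle[OF regular_solution_uminus[OF sol] \<alpha> \<sigma> T' _ _ _ robin' x])
    show "- w x 0 \<le> M" if "x \<in> {0..1}" for x using init[OF that] by simp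
    show "- f x t \<le> (lam - \<sigma>) * (M * exp (- \<sigma> * t))" if "x \<in> {0..1}" "t \<in> {0<..T}" for x t
      using f[OF that] by linarith
    show "- p 0 t = 0 \<or> - w 0 t \<le> M * exp (- \<sigma> * t)" if "t \<in> {0<..T}" for t
      using bc0[OF that] by linarith
  qed auto
  ultimately show ?thesis by simp
qed

subsection \<open>Regularity of classical solutions\<close>

text \<open>The Sobolev bound turns continuity in time with values in H^2 into continuity in time
  uniform in x; continuity in x at the single time \<open>s\<close> does the rest. The bound is
  applied to the difference itself, so no relation between the representatives chosen by
  \<open>wderiv\<close> at different times enters.\<close>

lemma H2_solution_jointly_continuous:
  assumes cont: "\<And>t. t \<ge> 0 \<Longrightarrow> continuous_on {0..1} (\<lambda>x. w x t)"
    and into: "cont_into H2 H2_norm w"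
  shows "continuous_on ({0..1} \<times> {0..}) (\<lambda>(x, t). w x t)"
proof -
  have H1: "(\<lambda>x. w x t) \<in> H1" if "t \<ge> 0" for t
    using into that by (simp add: cont_into_def H2_def)
  have bound: "\<bar>w x t - w x s\<bar> \<le> 2 * H2_norm (\<lambda>x. w x t - w x s)"
    if "x \<in> {0..1}" "s \<ge> 0" "t \<ge> 0" for x s t
    using H1_sup_bound_H2_norm[OF H1_diff[OF H1 H1] continuous_on_diff[OF cont cont]] that by simp
  have unif: "\<exists>d>0. \<forall>t\<ge>0. \<bar>t - s\<bar> < d \<longrightarrow> (\<forall>x\<in>{0..1}. \<bar>w x t - w x s\<bar> < e)"
    if s: "s \<ge> 0" and e: "e > 0" for s e
  proof -
    have "((\<lambda>t. H2_norm (\<lambda>x. w x t - w x s)) \<longlongrightarrow> 0) (at s within {0..})"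
      using into s by (simp add: cont_into_def)
    then have "eventually (\<lambda>t. H2_norm (\<lambda>x. w x t - w x s) < e / 2) (at s within {0..})"
      using e by (intro order_tendstoD(2)) auto
    then obtain d where d: "d > 0"
      "\<And>t. t \<ge> 0 \<Longrightarrow> t \<noteq> s \<Longrightarrow> \<bar>t - s\<bar> < d \<Longrightarrow> H2_norm (\<lambda>x. w x t - w x s) < e / 2"
      unfolding eventually_at dist_real_def by auto
    have "\<bar>w x t - w x s\<bar> < e" if "t \<ge> 0" "\<bar>t - s\<bar> < d" "x \<in> {0..1}" for t x
    proof (cases "t = s")
      case True then show ?thesis using e by simp
    next
      case False
      then show ?thesis using d(2)[of t] bound[OF that(3) s that(1)] that by linarith
    qed
    then show ?thesis using d(1) by blast
  qed
  show ?thesis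
    unfolding continuous_on_iff
  proof (intro ballI allI impI)
    fix z e :: real and q assume q: "q \<in> {0..1::real} \<times> ({0..} :: real set)" and e: "(0::real) < e"
    obtain x s where xs: "q = (x, s)" "x \<in> {0..1}" "s \<ge> 0" using q by auto
    obtain d1 where d1: "d1 > 0" "\<And>t y. t \<ge> 0 \<Longrightarrow> \<bar>t - s\<bar> < d1 \<Longrightarrow> y \<in> {0..1} \<Longrightarrow> \<bar>w y t - w y s\<bar> < e / 2"
      using unif[OF xs(3), of "e / 2"] e by auto
    obtain d2 where d2: "d2 > 0" "\<And>y. y \<in> {0..1} \<Longrightarrow> \<bar>y - x\<bar> < d2 \<Longrightarrow> \<bar>w y s - w x s\<bar> < e / 2"
      using cont[OF xs(3), unfolded continuous_on_iff, rule_format, OF xs(2), of "e / 2"] e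
      unfolding dist_real_def by auto
    show "\<exists>d>0. \<forall>q'\<in>{0..1} \<times> {0..}. dist q' q < d \<longrightarrow>
        dist (case q' of (x, t) \<Rightarrow> w x t) (case q of (x, t) \<Rightarrow> w x t) < e"
    proof (intro exI[of _ "min d1 d2"] conjI ballI impI)
      fix q' assume q': "q' \<in> {0..1::real} \<times> ({0..} :: real set)" and dist: "dist q' q < min d1 d2"
      obtain y t where yt: "q' = (y, t)" "y \<in> {0..1}" "t \<ge> 0" using q' by auto
      have "dist y x \<le> dist q' q" "dist t s \<le> dist q' q"
        using dist_fst_le[of q' q] dist_snd_le[of q' q] yt xs by auto
      then have "\<bar>y - x\<bar> < d2" "\<bar>t - s\<bar> < d1" using dist by (auto simp: dist_real_def)
      then have "\<bar>w y t - w y s\<bar> < e / 2" "\<bar>w y s - w x s\<bar> < e / 2"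
        using d1(2)[OF yt(3) _ yt(2)] d2(2)[OF yt(2)] by auto
      then show "dist (case q' of (x, t) \<Rightarrow> w x t) (case q of (x, t) \<Rightarrow> w x t) < e"
        unfolding xs(1) yt(1) dist_real_def prod.case by linarith
    qed (use d1(1) d2(1) in simp)
  qed
qed

text \<open>At each time the twofold weak derivative gets a continuous primitive, chosen as
  \<open>p\<close>. The L^2 limit of the time quotients implies the L^1 limit, because the interval
  has measure 1.\<close>

lemma classical_solution_imp_regular:
  assumes sol: "classical_solution \<alpha> lam f w"
  obtains p w' where "regular_solution \<alpha> lam f w p w'"
proof -
  have cont: "\<And>t. t \<ge> 0 \<Longrightarrow> continuous_on {0..1} (\<lambda>x. w x t)" and into: "cont_into H2 H2_norm w"
    using sol by (auto simp: classical_solution_def)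
  obtain w' where w': "L2_time_deriv w w'" "cont_into L2 L2_norm w'"
    "\<And>t. t > 0 \<Longrightarrow> AE x in lebesgue_on {0<..<1}.
       w' x t = \<alpha> * wderiv (wderiv (\<lambda>y. w y t)) x - lam * w x t + f x t"
    using sol by (auto simp: classical_solution_def)
  define g where "g = (\<lambda>t. wderiv (wderiv (\<lambda>x. w x t)))"
  have H2: "(\<lambda>x. w x t) \<in> H2" if "t \<ge> 0" for t using into that by (simp add: cont_into_def)
  have L2: "(\<lambda>x. w x t) \<in> L2" if "t \<ge> 0" for t using H2[OF that] by (simp add: H2_def H1_def)
  have w'_L2: "(\<lambda>x. w' x t) \<in> L2" if "t \<ge> 0" for t using w'(2) that by (simp add: cont_into_def)
  have "\<forall>t. \<exists>p. t \<ge> 0 \<longrightarrow> continuous_on {0..1} p \<and>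
    (\<forall>x\<in>{0..1}. ((\<lambda>x. w x t) has_real_derivative p x) (at x within {0..1})) \<and>
    (\<forall>x\<in>{0..1}. (g t has_integral (p x - p 0)) {0..x})"
  proof
    fix t :: real
    show "\<exists>p. t \<ge> 0 \<longrightarrow> continuous_on {0..1} p \<and>
      (\<forall>x\<in>{0..1}. ((\<lambda>x. w x t) has_real_derivative p x) (at x within {0..1})) \<and>
      (\<forall>x\<in>{0..1}. (g t has_integral (p x - p 0)) {0..x})"
    proof (cases "t \<ge> 0")
      case True
      show ?thesis
        by (rule H2_continuous_representation[OF H2[OF True] cont[OF True]]) (auto simp: g_def)
    qed simp
  qed
  from choice[OF this] obtain P where P_all: "\<forall>t. t \<ge> 0 \<longrightarrow> continuous_on {0..1} (P t) \<and>
    (\<forall>x\<in>{0..1}. ((\<lambda>x. w x t) has_real_derivative P t x) (at x within {0..1})) \<and>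
    (\<forall>x\<in>{0..1}. (g t has_integral (P t x - P t 0)) {0..x})"
    by (elim exE) (rule that)
  have P: "continuous_on {0..1} (P t)"
    "x \<in> {0..1} \<Longrightarrow> ((\<lambda>x. w x t) has_real_derivative P t x) (at x within {0..1})"
    "x \<in> {0..1} \<Longrightarrow> (g t has_integral (P t x - P t 0)) {0..x}" if "t \<ge> 0" for t x
    using P_all[rule_format, OF that] by simp_all
  have "regular_solution \<alpha> lam f w (\<lambda>x t. P t x) w'"
    unfolding regular_solution_def
  proof (intro conjI allI impI ballI)
    show "continuous_on ({0..1} \<times> {0..}) (\<lambda>(x, t). w x t)"
      by (rule H2_solution_jointly_continuous[OF cont into])
    show "continuous_on {0..1} (P t)" if "t \<ge> 0" for t by (rule P(1)[OF that])
    show "((\<lambda>x. w x t) has_real_derivative P t x) (at x within {0..1})"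
      if "t \<ge> 0" "x \<in> {0..1}" for t x by (rule P(2)[OF that])
    fix t :: real assume t: "t > 0"
    then have t0: "t \<ge> 0" by simp
    have g_def_at: "g t = wderiv (wderiv (\<lambda>y. w y t))" by (simp add: g_def)
    obtain N where N: "negligible N"
      "\<And>x. x \<in> {0..1} - N \<Longrightarrow> w' x t = \<alpha> * g t x - lam * w x t + f x t"
      using AE_unit_imp_negligible[OF w'(3)[OF t, folded g_def_at]] by blast
    show w'_ai: "(\<lambda>x. w' x t) absolutely_integrable_on {0..1}"
      by (rule L2_absolutely_integrable(1)[OF w'_L2[OF t0]])
    have g_ai: "g t absolutely_integrable_on {0..1}"
      unfolding g_def using H2[OF t0] by (intro L2_absolutely_integrable(1) H1_wderiv(2)) (simp add: H2_def)
    have wg_ai: "(\<lambda>x. w' x t + lam * w x t - \<alpha> * g t x) absolutely_integrable_on {0..1}"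
      by (intro set_integral_diff(1) set_integral_add(1) w'_ai
          absolutely_integrable_continuous_real continuous_on_mult_left cont[OF t0]
          absolutely_integrable_continuous_mult[OF continuous_on_const g_ai])
    \<comment> \<open>Integrability of the source comes from the equation, which expresses it off a
      null set through integrable functions.\<close>
    show "(\<lambda>x. f x t) absolutely_integrable_on {0..1}"
      by (rule absolutely_integrable_spike[OF wg_ai N(1)]) (use N(2) in auto)
    show "((\<lambda>y. w' y t + lam * w y t - f y t) has_integral \<alpha> * (P t x - P t 0)) {0..x}"
      if x: "x \<in> {0..1}" for x
      by (rule has_integral_spike[OF N(1) _ has_integral_mult_right[OF P(3)[OF t0 x]]])
         (use N(2) x in auto)
    have lim: "((\<lambda>s. L2_norm (\<lambda>x. (w x s - w x t) / (s - t) - w' x t)) \<longlongrightarrow> 0) (at t within {0..})"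
      using w'(1) t0 by (simp add: L2_time_deriv_def)
    have "norm (integral {0..1} (\<lambda>x. \<bar>(w x s - w x t) / (s - t) - w' x t\<bar>))
        \<le> L2_norm (\<lambda>x. (w x s - w x t) / (s - t) - w' x t)" if s: "s \<ge> 0" for s
    proof -
      have "(\<lambda>x. inverse (s - t) * (w x s - w x t) - w' x t) \<in> L2"
        by (intro L2_diff L2_cmult L2 w'_L2 s t0)
      then have L: "(\<lambda>x. (w x s - w x t) / (s - t) - w' x t) \<in> L2"
        by (simp add: divide_inverse mult.commute)
      note A = L2_absolutely_integrable[OF L]
      have "0 \<le> integral {0..1} (\<lambda>x. \<bar>(w x s - w x t) / (s - t) - w' x t\<bar>)"
        using A(1) by (intro integral_nonneg) (auto simp: absolutely_integrable_on_def)
      then show ?thesis using A(2) by simp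
    qed
    then have "eventually (\<lambda>s. norm (integral {0..1} (\<lambda>x. \<bar>(w x s - w x t) / (s - t) - w' x t\<bar>))
        \<le> L2_norm (\<lambda>x. (w x s - w x t) / (s - t) - w' x t)) (at t within {0..})"
      unfolding eventually_at_filter by (intro always_eventually) auto
    then show "((\<lambda>s. integral {0..1} (\<lambda>x. \<bar>(w x s - w x t) / (s - t) - w' x t\<bar>)) \<longlongrightarrow> 0) (at t within {0..})"
      by (rule Lim_null_comparison[OF _ lim])
  qed
  then show thesis by (rule that)
qed

lemma regular_solution_dx:
  assumes "regular_solution \<alpha> lam f w p w'" "t \<ge> 0" "x \<in> {0..1}"
  shows "dx (\<lambda>x. w x t) x = p x t"
  unfolding dx_def using regular_solutionD(3)[OF assms] assms(3)
  by (intro vector_derivative_within_closed_interval)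
     (auto simp: has_real_derivative_iff_has_vector_derivative)

subsection \<open>Gains around the cycle\<close>

lemma prod_lessThan_diff:
  fixes k :: "nat \<Rightarrow> real"
  assumes "m \<le> n"
  shows "(\<Prod>s<m. k (n - s)) = (\<Prod>j=n - m + 1..n. k j)"
  by (rule prod.reindex_bij_witness[of _ "\<lambda>j. n - j" "\<lambda>s. n - s"]) (use assms in auto)

text \<open>\<open>M_const N k l N\<close> contains the summand \<open>m = N\<close>, which equals \<open>N_const N k l\<close>;
  the other \<open>M_const N k l i\<close> stop at \<open>m = N - 1\<close>.  Dropping it makes the gains cyclic.\<close>

definition M_cyc :: "nat \<Rightarrow> (nat \<Rightarrow> real) \<Rightarrow> real \<Rightarrow> nat \<Rightarrow> real" where
  "M_cyc N k l i = M_const N k l i - (if i = N then N_const N k l else 0)"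

text \<open>\<open>M_cyc\<close> sums the gain products over backward chains from \<open>i\<close>
  of lengths 0 to N - 1. Prepending \<open>k i / l\<close> to the chains from the predecessor
  lengthens each by one: the empty chain is lost, hence \<open>- 1\<close>, and the full cycle
  appears, hence \<open>+ N_const N k l\<close>.\<close>

lemma M_cyc_recurrence:
  assumes N: "N \<ge> 2" and i: "i \<in> {1..N}"
  shows "k i / l * M_cyc N k l (wrap N (i - 1)) = M_cyc N k l i - 1 + N_const N k l"
proof -
  \<comment> \<open>\<open>A\<close> collects chains that stay among the indices 1 to i,
    \<open>B\<close> those that pass below 1 and continue from N.\<close>
  define A where "A = (\<lambda>i m. (\<Prod>r<m. k (i - r)) / l ^ m)"
  define B where "B = (\<lambda>i m. (\<Prod>r<i. k (i - r)) * (\<Prod>s<m-i. k (N - s)) / l ^ m)"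
  have M: "M_const N k l i = 1 + (\<Sum>m=1..i. A i m) + (\<Sum>m=i+1..N-1. B i m)" for i
    by (simp add: M_const_def A_def B_def)
  have full: "A N N = N_const N k l"
    by (simp add: A_def N_const_def prod_lessThan_diff)
  have B_full: "B i N = N_const N k l"
  proof -
    have "(\<Prod>r<i. k (i - r)) * (\<Prod>s<N-i. k (N - s)) = (\<Prod>j=1..i. k j) * (\<Prod>j=i+1..N. k j)"
      using i by (simp add: prod_lessThan_diff)
    also have "\<dots> = (\<Prod>j=1..N. k j)"
      using i prod.ub_add_nat[of 1 i k "N - i"] by simp
    finally show ?thesis by (simp add: B_def N_const_def)
  qed
  \<comment> \<open>The shift adds the chain of length N, which is the full cycle; for
    \<open>i = N\<close> both ranges are empty.\<close>
  have B_sum: "(\<Sum>m=i..N-1. B i (Suc m)) = (\<Sum>m=i+1..N-1. B i m) + (if i = N then 0 else N_const N k l)"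
  proof -
    have "(\<Sum>m=i..N-1. B i (Suc m)) = (\<Sum>m=Suc i..Suc (N-1). B i m)"
      by (rule sum.shift_bounds_cl_Suc_ivl[symmetric])
    also have "Suc (N - 1) = N" using N by simp
    also have "(\<Sum>m=Suc i..N. B i m) = (\<Sum>m=i+1..N-1. B i m) + (if i = N then 0 else B i N)"
    proof (cases "i = N")
      case False
      then have "(\<Sum>m=Suc i..N. B i m) = (\<Sum>m=Suc i..<N. B i m) + B i N"
        using i by (simp add: sum.last_plus add.commute)
      also have "{Suc i..<N} = {i+1..N-1}" using N by auto
      finally show ?thesis using False by simp
    qed simp
    finally show ?thesis using B_full by simp
  qed
  show ?thesis
  proof (cases "i = 1")
    case True
    \<comment> \<open>For \<open>i = 1\<close> the predecessor is N, so its non-wrapping chains turn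
      into wrapping ones.\<close>
    have step: "k i / l * A N m = B i (Suc m)" for m by (simp add: True A_def B_def)
    have "(\<Sum>m=1..N. A N m) = (\<Sum>m=1..<N. A N m) + A N N"
      using N by (simp add: sum.last_plus add.commute)
    also have "{1..<N} = {i..N-1}" using True N by auto
    finally have "M_cyc N k l N = 1 + (\<Sum>m=i..N-1. A N m)"
      unfolding M_cyc_def M using full by simp
    then have "k i / l * M_cyc N k l N = k i / l + (\<Sum>m=i..N-1. B i (Suc m))"
      by (simp only: distrib_left sum_distrib_left step mult_1_right)
    also have "\<dots> = M_cyc N k l i - 1 + N_const N k l"
      unfolding B_sum M_cyc_def M using True N by (simp add: A_def)
    finally show ?thesis using True by (simp add: wrap_def)
  next
    case False
    then have i2: "i \<ge> 2" using i by auto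
    have A_step: "k i / l * A (i - 1) m = A i (Suc m)" for m
      unfolding A_def prod.lessThan_Suc_shift by simp
    have B_step: "k i / l * B (i - 1) m = B i (Suc m)" for m
    proof -
      obtain j where j: "i = Suc j" using i2 by (cases i) auto
      have "(\<Prod>r<Suc j. k (Suc j - r)) = k (Suc j) * (\<Prod>r<j. k (j - r))"
        unfolding prod.lessThan_Suc_shift by simp
      then show ?thesis by (simp add: B_def j)
    qed
    have A_sum: "k i / l * (1 + (\<Sum>m=1..i-1. A (i - 1) m)) = (\<Sum>m=1..i. A i m)"
    proof -
      have "(\<Sum>m=1..i-1. A i (Suc m)) = (\<Sum>m=Suc 1..Suc (i-1). A i m)"
        by (rule sum.shift_bounds_cl_Suc_ivl[symmetric])
      moreover have "(\<Sum>m=1..i. A i m) = A i 1 + (\<Sum>m=Suc 1..i. A i m)"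
        using i2 by (intro sum.atLeast_Suc_atMost) simp
      moreover have "A i 1 = k i / l" by (simp add: A_def)
      moreover have "Suc (i - 1) = i" using i2 by simp
      ultimately show ?thesis
        by (simp only: distrib_left sum_distrib_left A_step mult_1_right)
    qed
    have "M_cyc N k l (i - 1) = (1 + (\<Sum>m=1..i-1. A (i - 1) m)) + (\<Sum>m=i..N-1. B (i - 1) m)"
      unfolding M_cyc_def M using i i2 by auto
    then have "k i / l * M_cyc N k l (i - 1) = (\<Sum>m=1..i. A i m) + (\<Sum>m=i..N-1. B i (Suc m))"
      unfolding A_sum[symmetric] by (simp only: distrib_left sum_distrib_left B_step)
    also have "\<dots> = M_cyc N k l i - 1 + N_const N k l"
      unfolding B_sum M_cyc_def M by simp
    finally show ?thesis using i2 by (simp add: wrap_def)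
  qed
qed

lemma N_const_bounds:
  assumes "N \<ge> 1" and gains: "\<And>i. i \<in> {1..N} \<Longrightarrow> 0 < k i \<and> k i < l"
  shows "0 \<le> N_const N k l" "N_const N k l < 1"
proof -
  have l: "l > 0" using gains[of 1] assms(1) by auto
  have eq: "N_const N k l = (\<Prod>n=1..N. k n / l)"
    by (simp add: N_const_def prod_dividef)
  show "0 \<le> N_const N k l" unfolding eq using gains l by (intro prod_nonneg) (auto simp: less_imp_le)
  have "(\<Prod>n=1..N. k n / l) < (\<Prod>n=1..N. 1)"
    using gains l assms(1) by (intro prod_mono_strict) (auto simp: less_imp_le)
  then show "N_const N k l < 1" unfolding eq by simp
qed

text \<open>At an index where \<open>E\<close> is largest, the inequality bounds the maximum by a
  factor below 1 times itself, so the maximum cannot be positive. The argument works for any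
  self-map of the index set in place of the cyclic shift.\<close>

lemma cyclic_contraction:
  fixes E c :: "nat \<Rightarrow> real"
  assumes N: "N \<ge> 1" and contr: "\<And>i. i \<in> {1..N} \<Longrightarrow> 0 \<le> c i \<and> c i < 1"
    and wrap: "\<And>i. i \<in> {1..N} \<Longrightarrow> \<pi> i \<in> {1..N}"
    and le: "\<And>i. i \<in> {1..N} \<Longrightarrow> E i \<le> c i * E (\<pi> i)"
    and i: "i \<in> {1..N}"
  shows "E i \<le> 0"
proof -
  have "Max (E ` {1..N}) \<in> E ` {1..N}" using i by (intro Max_in) auto
  then obtain j where j: "j \<in> {1..N}" "E j = Max (E ` {1..N})" by auto
  have max: "E n \<le> E j" if "n \<in> {1..N}" for n using that j(2) by simp
  have "E j \<le> 0"
  proof (rule ccontr)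
    assume "\<not> E j \<le> 0"
    then have "c j * E j < E j" using contr[OF j(1)] by simp
    moreover have "c j * E (\<pi> j) \<le> c j * E j"
      using contr[OF j(1)] max[OF wrap[OF j(1)]] by (intro mult_left_mono) auto
    ultimately show False using le[OF j(1)] by linarith
  qed
  then show ?thesis using max[OF i] by linarith
qed

lemma wrap_pred: "i \<in> {1..N} \<Longrightarrow> wrap N (i - 1) \<in> {1..N}"
  by (auto simp: wrap_def)

text \<open>The normalised \<open>M_cyc\<close> solves the system with equality for G = 1, so
  subtracting \<open>c i * G\<close> leaves a homogeneous system, to which the contraction applies.
  Using the inequality once more at \<open>i\<close> produces \<open>C_tilde\<close> from the
  constant of the predecessor.\<close>

lemma M_cyc_bound:
  assumes N: "N \<ge> 2" and gains: "\<And>i. i \<in> {1..N} \<Longrightarrow> 0 < k i \<and> k i < l" and G: "G \<ge> 0"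
    and E: "\<And>i. i \<in> {1..N} \<Longrightarrow> E i \<le> G + k i / l * E (wrap N (i - 1))"
    and i: "i \<in> {1..N}"
  shows "E i \<le> C_tilde N k l i * G"
proof -
  have N1: "N \<ge> 1" using N by simp
  have nu: "0 \<le> N_const N k l" "N_const N k l < 1"
    by (rule N_const_bounds[of N k l]; use N1 gains in blast)+
  have l: "l > 0" using gains[OF i] by linarith
  define c where "c = (\<lambda>i. M_cyc N k l i / (1 - N_const N k l))"
  have fixpoint: "c i = 1 + k i / l * c (wrap N (i - 1))" if "i \<in> {1..N}" for i
  proof -
    have "k i / l * c (wrap N (i - 1)) = (k i / l * M_cyc N k l (wrap N (i - 1))) / (1 - N_const N k l)"
      unfolding c_def by (simp only: times_divide_eq_right)
    also have "\<dots> = (M_cyc N k l i - (1 - N_const N k l)) / (1 - N_const N k l)"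
      unfolding M_cyc_recurrence[OF N that] by (simp add: algebra_simps)
    also have "\<dots> = c i - 1" unfolding c_def using nu by (simp add: diff_divide_distrib)
    finally show ?thesis by simp
  qed
  have bound: "E i - c i * G \<le> 0" if "i \<in> {1..N}" for i
  proof (rule cyclic_contraction[OF N1, of "\<lambda>i. k i / l" "\<lambda>i. wrap N (i - 1)" "\<lambda>i. E i - c i * G"])
    show "0 \<le> k i / l \<and> k i / l < 1" if "i \<in> {1..N}" for i using gains[OF that] l by simp
    show "E i - c i * G \<le> k i / l * (E (wrap N (i - 1)) - c (wrap N (i - 1)) * G)"
      if "i \<in> {1..N}" for i
      using E[OF that] unfolding fixpoint[OF that] by (simp add: algebra_simps)
  qed (use wrap_pred that in auto)
  let ?j = "wrap N (i - 1)"
  \<comment> \<open>The two differ only at index N, where \<open>C_const\<close> retains the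
    full-cycle summand.\<close>
  have "c ?j \<le> C_const N k l ?j"
    unfolding c_def C_const_def M_cyc_def using nu by (intro divide_right_mono) auto
  then have "c ?j * G \<le> C_const N k l ?j * G" using G by (rule mult_right_mono)
  then have "E ?j \<le> C_const N k l ?j * G" using bound[OF wrap_pred[OF i]] by linarith
  then have "k i / l * E ?j \<le> k i / l * (C_const N k l ?j * G)"
    using gains[OF i] l by (intro mult_left_mono) auto
  then show ?thesis using E[OF i] by (simp add: C_tilde_def algebra_simps)
qed

section \<open>Supremum norms of the data\<close>

lemma C_norm_upper:
  assumes "compact K" "continuous_on K h" "x \<in> K"
  shows "\<bar>h x\<bar> \<le> C_norm K h"
proof -
  have "compact ((\<lambda>x. \<bar>h x\<bar>) ` K)"
    using assms by (intro compact_continuous_image continuous_intros) auto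
  then show ?thesis
    unfolding C_norm_def using assms(3)
    by (intro cSUP_upper bounded_imp_bdd_above compact_imp_bounded)
qed

lemma C_norm_least: "K \<noteq> {} \<Longrightarrow> (\<And>x. x \<in> K \<Longrightarrow> \<bar>h x\<bar> \<le> c) \<Longrightarrow> C_norm K h \<le> c"
  unfolding C_norm_def by (rule cSUP_least)

lemma abs_bound_on_closure:
  fixes h :: "real \<Rightarrow> real"
  assumes cont: "continuous_on {a..b} h" and "a < b"
    and bound: "\<And>x. x \<in> {a<..<b} \<Longrightarrow> \<bar>h x\<bar> \<le> c" and x: "x \<in> {a..b}"
  shows "\<bar>h x\<bar> \<le> c"
proof -
  have cl: "closure {a<..<b} = {a..b}" using \<open>a < b\<close> by simp
  show ?thesis
    using continuous_le_on_closure[of "{a<..<b}" "\<lambda>x. \<bar>h x\<bar>" x c] cont bound x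
    unfolding cl by (auto intro: continuous_intros)
qed

text \<open>The values of \<open>h\<close> at the end points are arbitrary, so its supremum norm over \<open>{a..b}\<close>
  need not be that of \<open>g\<close>.\<close>

lemma abs_le_C_norm_of_extension:
  fixes g h :: "real \<Rightarrow> real"
  assumes cont: "continuous_on {a..b} g" and "a < b"
    and eq: "\<And>x. x \<in> {a<..<b} \<Longrightarrow> g x = h x" and x: "x \<in> {a..b}"
  shows "\<bar>g x\<bar> \<le> C_norm {a..b} h"
proof (rule abs_bound_on_closure[OF cont \<open>a < b\<close> _ x])
  fix y assume y: "y \<in> {a<..<b}"
  \<comment> \<open>A real supremum dominates its members only for a set bounded above; the two
    arbitrary end values do not spoil boundedness.\<close>
  have "\<bar>h z\<bar> \<le> max (C_norm {a..b} g) (max \<bar>h a\<bar> \<bar>h b\<bar>)" if z: "z \<in> {a..b}" for z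
  proof (cases "z \<in> {a<..<b}")
    case True
    then have "\<bar>h z\<bar> \<le> C_norm {a..b} g" using C_norm_upper[OF _ cont, of z] eq[of z] z by auto
    then show ?thesis by simp
  next
    case False
    then have "z = a \<or> z = b" using z by auto
    then show ?thesis by auto
  qed
  then have "bdd_above ((\<lambda>z. \<bar>h z\<bar>) ` {a..b})" by (intro bdd_aboveI2)
  then have "\<bar>h y\<bar> \<le> C_norm {a..b} h"
    unfolding C_norm_def using y by (intro cSUP_upper) auto
  then show "\<bar>g y\<bar> \<le> C_norm {a..b} h" using eq[OF y] by simp
qed

lemma C1_nonneg_continuous: "C1_nonneg g \<Longrightarrow> continuous_on {0..t} g"
  unfolding C1_nonneg_def
  by (elim exE conjE, rule continuous_on_subset[of "{0..}"], rule DERIV_continuous_on) auto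

subsection \<open>The tracking error\<close>

theorem theorem3p2:
  fixes N :: nat and \<alpha> lam l \<sigma> :: real and k :: "nat \<Rightarrow> real"
    and u v qh f :: "nat \<Rightarrow> real \<Rightarrow> real \<Rightarrow> real" and uref :: "real \<Rightarrow> real \<Rightarrow> real"
    and u0 v0 qh0 :: "nat \<Rightarrow> real \<Rightarrow> real" and uref0 :: "real \<Rightarrow> real"
    and q d0 d1 U0 U1 :: "nat \<Rightarrow> real \<Rightarrow> real" and r :: "real \<Rightarrow> real"
    and ut :: "nat \<Rightarrow> real \<Rightarrow> real \<Rightarrow> real" and ut0 :: "nat \<Rightarrow> real \<Rightarrow> real"
  assumes N: "N \<ge> 2"
    and const: "\<alpha> > 0" "lam > 0" "l > 0"
    and gains: "\<And>i. i \<in> {1..N} \<Longrightarrow> 0 < k i \<and> k i < l"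
    and sigma: "0 < \<sigma>" "\<sigma> < lam"
    \<comment> \<open>tracking errors\<close>
    and ut: "ut = (\<lambda>i x t. u i x t - uref x t)"
    and ut0: "ut0 = (\<lambda>i x. u0 i x - uref0 x)"
    \<comment> \<open>regularity of the data\<close>
    and f_cont: "\<And>i. i \<in> {1..N} \<Longrightarrow> continuous_on ({0..1} \<times> {0..}) (\<lambda>(x, t). f i x t)"
    and data_C1: "\<And>i. i \<in> {1..N} \<Longrightarrow> C1_nonneg (d0 i) \<and> C1_nonneg (d1 i) \<and> C1_nonneg (q i)"
    and r_C1: "C1_nonneg r"
    and ut0_reg: "\<And>i. i \<in> {1..N} \<Longrightarrow> ut0 i \<in> H2 \<and> continuous_on {0..1} (ut0 i)"
    and uref0_reg: "uref0 \<in> H2 \<and> continuous_on {0..1} uref0"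
    and v0_reg: "\<And>i. i \<in> {1..N} \<Longrightarrow> v0 i \<in> H2 \<and> continuous_on {0..1} (v0 i)"
    \<comment> \<open>compatibility conditions\<close>
    and ut0_compat: "\<And>i. i \<in> {1..N} \<Longrightarrow>
          ut0 i 0 = q i 0 + d0 i 0 - qh0 i 0 \<and>
          dx (ut0 i) 1 = - l * ut0 i 1 + k i * ut0 (wrap N (i - 1)) 1 + d1 i 0"
    and uref0_compat: "uref0 0 = r 0" "dx uref0 1 = - l * uref0 1"
    and v0_compat: "\<And>i. i \<in> {1..N} \<Longrightarrow>
          v0 i 0 = U0 i 0 \<and> dx (v0 i) 1 = - l * v0 i 1 + U1 i 0"
    \<comment> \<open>agents\<close>
    and u_pde: "\<And>i. i \<in> {1..N} \<Longrightarrow> classical_solution \<alpha> lam (f i) (u i)"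
    and u_bc: "\<And>i t. i \<in> {1..N} \<Longrightarrow> t > 0 \<Longrightarrow>
          u i 0 t = q i t + U0 i t \<and> dx (\<lambda>x. u i x t) 1 = - l * u i 1 t + U1 i t"
    and u_ic: "\<And>i x. i \<in> {1..N} \<Longrightarrow> x \<in> {0<..<1} \<Longrightarrow> u i x 0 = u0 i x"
    \<comment> \<open>reference\<close>
    and uref_pde: "classical_solution \<alpha> lam (\<lambda>x t. 0) uref"
    and uref_bc: "\<And>t. t > 0 \<Longrightarrow>
          uref 0 t = r t \<and> dx (\<lambda>x. uref x t) 1 = - l * uref 1 t"
    and uref_ic: "\<And>x. x \<in> {0<..<1} \<Longrightarrow> uref x 0 = uref0 x"
    \<comment> \<open>auxiliary system\<close>
    and v_pde: "\<And>i. i \<in> {1..N} \<Longrightarrow> classical_solution \<alpha> lam (\<lambda>x t. 0) (v i)"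
    and v_bc: "\<And>i t. i \<in> {1..N} \<Longrightarrow> t > 0 \<Longrightarrow>
          v i 0 t = U0 i t \<and> dx (\<lambda>x. v i x t) 1 = - l * v i 1 t + U1 i t"
    and v_ic: "\<And>i x. i \<in> {1..N} \<Longrightarrow> x \<in> {0<..<1} \<Longrightarrow> v i x 0 = v0 i x"
    \<comment> \<open>disturbance observer\<close>
    and qh_pde: "\<And>i. i \<in> {1..N} \<Longrightarrow> classical_solution \<alpha> lam (\<lambda>x t. 0) (qh i)"
    and qh_bc: "\<And>i t. i \<in> {1..N} \<Longrightarrow> t > 0 \<Longrightarrow>
          dx (\<lambda>x. qh i x t) 0 = dx (\<lambda>x. u i x t) 0 - dx (\<lambda>x. v i x t) 0 \<and>
          dx (\<lambda>x. qh i x t) 1 = - l * qh i 1 t"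
    and qh_ic: "\<And>i x. i \<in> {1..N} \<Longrightarrow> x \<in> {0<..<1} \<Longrightarrow> qh i x 0 = qh0 i x"
    \<comment> \<open>control laws\<close>
    and U0: "\<And>i t. i \<in> {1..N} \<Longrightarrow> t \<ge> 0 \<Longrightarrow> U0 i t = r t - qh i 0 t + d0 i t"
    and U1: "\<And>i t. i \<in> {1..N} \<Longrightarrow> t \<ge> 0 \<Longrightarrow>
          U1 i t = k i * (u (wrap N (i - 1)) 1 t - uref 1 t) + d1 i t"
  shows "\<forall>i\<in>{1..N}. \<forall>t>0.
     C_norm {0..1} (\<lambda>x. ut i x t)
     \<le> C_tilde N k l i * D_fun N l lam \<sigma> f d0 d1 t
       + C_tilde N k l i * exp (- \<sigma> * t) *
           (Max ((\<lambda>n. C_norm {0..1} (ut0 n)) ` {1..N})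
            + Max ((\<lambda>n. C_norm {0..1} (\<lambda>x. u0 n x - v0 n x - qh0 n x)) ` {1..N}))"
proof (intro ballI allI impI)
  fix i :: nat and T :: real
  assume i: "i \<in> {1..N}" and T: "T > 0"
  define F where "F = Max ((\<lambda>n. C_norm ({0..1} \<times> {0..T}) (\<lambda>(x, s). f n x s)) ` {1..N})"
  define D0 where "D0 = Max ((\<lambda>n. C_norm {0..T} (d0 n)) ` {1..N})"
  define D1 where "D1 = Max ((\<lambda>n. C_norm {0..T} (d1 n)) ` {1..N})"
  define A where "A = Max ((\<lambda>n. C_norm {0..1} (ut0 n)) ` {1..N})"
  define B where "B = Max ((\<lambda>n. C_norm {0..1} (\<lambda>x. u0 n x - v0 n x - qh0 n x)) ` {1..N})"
  define H where "H = exp (\<sigma> * T)"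
  define E where "E = (\<lambda>n. C_norm ({0..1} \<times> {0..T}) (\<lambda>(x, s). exp (\<sigma> * s) * ut n x s))"
  define G where "G = H * D_fun N l lam \<sigma> f d0 d1 T + A + B"
  have H: "H > 0" by (simp add: H_def)
  have ls: "lam - \<sigma> > 0" "\<sigma> \<le> lam" "0 \<le> lam" using sigma by auto
  have lpos: "l > 0" and alpha: "\<alpha> > 0" using const by auto

  have F: "\<bar>f n x s\<bar> \<le> F" if "n \<in> {1..N}" "x \<in> {0..1}" "s \<in> {0..T}" for n x s
  proof -
    have "continuous_on ({0..1} \<times> {0..T}) (\<lambda>(x, s). f n x s)"
      by (rule continuous_on_subset[OF f_cont[OF that(1)]]) auto
    from C_norm_upper[OF _ this, of "(x, s)"]
    have "\<bar>f n x s\<bar> \<le> C_norm ({0..1} \<times> {0..T}) (\<lambda>(x, s). f n x s)"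
      using that by (simp add: compact_Times)
    also have "\<dots> \<le> F" unfolding F_def using that(1) by (intro Max_ge) auto
    finally show ?thesis .
  qed
  have D0: "\<bar>d0 n s\<bar> \<le> D0" if "n \<in> {1..N}" "s \<in> {0..T}" for n s
  proof -
    have "\<bar>d0 n s\<bar> \<le> C_norm {0..T} (d0 n)"
      using data_C1[OF that(1)] that(2) by (intro C_norm_upper C1_nonneg_continuous) auto
    also have "\<dots> \<le> D0" unfolding D0_def using that(1) by (intro Max_ge) auto
    finally show ?thesis .
  qed
  have D1: "\<bar>d1 n s\<bar> \<le> D1" if "n \<in> {1..N}" "s \<in> {0..T}" for n s
  proof -
    have "\<bar>d1 n s\<bar> \<le> C_norm {0..T} (d1 n)"
      using data_C1[OF that(1)] that(2) by (intro C_norm_upper C1_nonneg_continuous) auto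
    also have "\<dots> \<le> D1" unfolding D1_def using that(1) by (intro Max_ge) auto
    finally show ?thesis .
  qed

  have init_ut: "\<bar>ut n x 0\<bar> \<le> A" if n: "n \<in> {1..N}" and x: "x \<in> {0..1}" for n x
  proof -
    have "continuous_on {0..1} (\<lambda>x. u n x 0 - uref x 0)"
      using u_pde[OF n] uref_pde by (intro continuous_on_diff) (auto simp: classical_solution_def)
    then have "\<bar>ut n x 0\<bar> \<le> C_norm {0..1} (ut0 n)"
      unfolding ut by (rule abs_le_C_norm_of_extension) (use x u_ic[OF n] uref_ic ut0 in auto)
    also have "\<dots> \<le> A" unfolding A_def using n by (intro Max_ge) auto
    finally show ?thesis .
  qed
  have init_obs: "\<bar>u n x 0 - v n x 0 - qh n x 0\<bar> \<le> B" if n: "n \<in> {1..N}" and x: "x \<in> {0..1}" for n x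
  proof -
    have "continuous_on {0..1} (\<lambda>x. u n x 0 - v n x 0 - qh n x 0)"
      using u_pde[OF n] v_pde[OF n] qh_pde[OF n]
      by (intro continuous_on_diff) (auto simp: classical_solution_def)
    then have "\<bar>u n x 0 - v n x 0 - qh n x 0\<bar> \<le> C_norm {0..1} (\<lambda>x. u0 n x - v0 n x - qh0 n x)"
      by (rule abs_le_C_norm_of_extension) (use x u_ic[OF n] v_ic[OF n] qh_ic[OF n] in auto)
    also have "\<dots> \<le> B" unfolding B_def using n by (intro Max_ge) auto
    finally show ?thesis .
  qed
  have nonneg: "F \<ge> 0" "D0 \<ge> 0" "D1 \<ge> 0" "A \<ge> 0" "B \<ge> 0"
    using F[OF i, of 0 0] D0[OF i, of 0] D1[OF i, of 0] init_ut[OF i, of 0] init_obs[OF i, of 0] T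
    by auto
  \<comment> \<open>On \<open>{0..T}\<close> the factor \<open>H\<close> pays for replacing a
    constant by a multiple of the decaying exponential.\<close>
  have scale: "X \<le> Y * exp (- \<sigma> * s)" if "X \<ge> 0" "X * H \<le> Y" "s \<in> {0..T}" for X Y s
  proof -
    have "H * exp (- \<sigma> * s) = exp (\<sigma> * (T - s))"
      unfolding H_def by (simp add: exp_add[symmetric] algebra_simps)
    moreover have "exp (\<sigma> * (T - s)) \<ge> 1" using sigma that by simp
    ultimately have "X \<le> X * (H * exp (- \<sigma> * s))" using that(1) by (simp add: mult_le_cancel_left1)
    also have "\<dots> \<le> Y * exp (- \<sigma> * s)"
      using mult_right_mono[OF that(2), of "exp (- \<sigma> * s)"] by (simp add: mult.assoc)
    finally show ?thesis .
  qed
  have F_scale: "\<bar>f n x s\<bar> \<le> (lam - \<sigma>) * (M * exp (- \<sigma> * s))"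
    if "n \<in> {1..N}" "x \<in> {0..1}" "s \<in> {0..T}" "H * F / (lam - \<sigma>) \<le> M" for n x s M
  proof -
    have "F / (lam - \<sigma>) \<le> M * exp (- \<sigma> * s)"
      using nonneg(1) ls that(3,4) by (intro scale) (auto simp: mult.commute)
    then have "F \<le> (lam - \<sigma>) * (M * exp (- \<sigma> * s))" using ls(1) by (simp add: divide_le_eq mult_ac)
    then show ?thesis using F[OF that(1-3)] by linarith
  qed

  \<comment> \<open>Subtracting \<open>v\<close> removes the controls and leaves \<open>q\<close> at
    0. The observer copies the flux of u - v there, so the difference has flux zero at 0 and a
    homogeneous Robin condition at 1. What remains is the initial error and the source
    \<open>f n\<close>.\<close>
  have obs: "\<bar>u n 0 s - v n 0 s - qh n 0 s\<bar> \<le> (B + H * F / (lam - \<sigma>)) * exp (- \<sigma> * s)"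
    if n: "n \<in> {1..N}" and s: "s \<in> {0..T}" for n s
  proof -
    obtain pu wu where ru: "regular_solution \<alpha> lam (f n) (u n) pu wu"
      by (rule classical_solution_imp_regular[OF u_pde[OF n]])
    obtain pv wv where rv: "regular_solution \<alpha> lam (\<lambda>x t. 0) (v n) pv wv"
      by (rule classical_solution_imp_regular[OF v_pde[OF n]])
    obtain pq wq where rq: "regular_solution \<alpha> lam (\<lambda>x t. 0) (qh n) pq wq"
      by (rule classical_solution_imp_regular[OF qh_pde[OF n]])
    note reg = regular_solution_diff[OF regular_solution_diff[OF ru rv] rq]
    have FM: "H * F / (lam - \<sigma>) \<le> B + H * F / (lam - \<sigma>)" "0 \<le> H * F / (lam - \<sigma>)"
      using nonneg H ls by auto
    show ?thesis
    proof (rule maximum_principle_abs[OF reg alpha ls(2,3), where b = "\<lambda>_. 0" and l = l])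
      show "\<bar>u n x 0 - v n x 0 - qh n x 0\<bar> \<le> B + H * F / (lam - \<sigma>)" if "x \<in> {0..1}" for x
        using init_obs[OF n that] FM by linarith
      show "\<bar>f n x t - 0 - 0\<bar> \<le> (lam - \<sigma>) * ((B + H * F / (lam - \<sigma>)) * exp (- \<sigma> * t))"
        if "x \<in> {0..1}" "t \<in> {0<..s}" for x t
        using F_scale[OF n that(1) _ FM(1), of t] that s by simp
      show "pu 0 t - pv 0 t - pq 0 t = 0 \<or>
          \<bar>u n 0 t - v n 0 t - qh n 0 t\<bar> \<le> (B + H * F / (lam - \<sigma>)) * exp (- \<sigma> * t)"
        if "t \<in> {0<..s}" for t
        using qh_bc[OF n, of t] that
        by (simp add: regular_solution_dx[OF ru] regular_solution_dx[OF rv] regular_solution_dx[OF rq])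
      show "pu 1 t - pv 1 t - pq 1 t = - l * (u n 1 t - v n 1 t - qh n 1 t) + 0"
        if "t \<in> {0<..s}" for t
        using u_bc[OF n, of t] v_bc[OF n, of t] qh_bc[OF n, of t] that
        by (simp add: regular_solution_dx[OF ru] regular_solution_dx[OF rv] regular_solution_dx[OF rq]
            algebra_simps)
      show "\<bar>0\<bar> \<le> l * ((B + H * F / (lam - \<sigma>)) * exp (- \<sigma> * t))" if "t \<in> {0<..s}" for t
        using FM nonneg lpos by simp
    qed (use s lpos in auto)
  qed

  have E_upper: "\<bar>ut n x s\<bar> \<le> E n * exp (- \<sigma> * s)"
    if n: "n \<in> {1..N}" and x: "x \<in> {0..1}" and s: "s \<in> {0..T}" for n x s
  proof -
    obtain pu wu where ru: "regular_solution \<alpha> lam (f n) (u n) pu wu"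
      by (rule classical_solution_imp_regular[OF u_pde[OF n]])
    obtain pr wr where rr: "regular_solution \<alpha> lam (\<lambda>x t. 0) uref pr wr"
      by (rule classical_solution_imp_regular[OF uref_pde])
    have "continuous_on ({0..1} \<times> {0..T}) (\<lambda>(x, t). ut n x t)"
      unfolding ut
      by (rule continuous_on_subset[OF regular_solutionD(1)[OF regular_solution_diff[OF ru rr]]]) auto
    then have "continuous_on ({0..1} \<times> {0..T}) (\<lambda>(x, s). exp (\<sigma> * s) * ut n x s)"
      by (auto simp: case_prod_beta intro!: continuous_intros)
    from C_norm_upper[OF _ this, of "(x, s)"]
    have "exp (\<sigma> * s) * \<bar>ut n x s\<bar> \<le> E n"
      using x s by (simp add: E_def compact_Times abs_mult)
    then show ?thesis by (simp add: exp_minus field_simps)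
  qed

  have G_ge: "H * (2 / (lam - \<sigma>) * F) + H * D0 + H * (1 / l * D1) + A + B = G"
    unfolding G_def D_fun_def F_def D0_def D1_def by (simp only: distrib_left)
  have parts: "0 \<le> H * (2 / (lam - \<sigma>) * F)" "0 \<le> H * D0" "0 \<le> H * (1 / l * D1)"
    using H nonneg ls lpos by auto
  have F2: "H * (2 / (lam - \<sigma>) * F) = 2 * (H * F / (lam - \<sigma>))" by simp

  have step: "E n \<le> G + k n / l * E (wrap N (n - 1))" if n: "n \<in> {1..N}" for n
  proof -
    define n' where "n' = wrap N (n - 1)"
    have n': "n' \<in> {1..N}" unfolding n'_def by (rule wrap_pred[OF n])
    \<comment> \<open>One level dominating all four requirements of the comparison: the initial
      error, the source, the Dirichlet datum fed by the observer error, and the Robin datum fed by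
      the predecessor.\<close>
    define M where "M = G + k n / l * E n'"
    have kn: "0 < k n" using gains[OF n] by simp
    have E': "E n' \<ge> 0" using E_upper[OF n', of 0 0] T by auto
    have kE: "0 \<le> k n / l * E n'" using kn lpos E' by simp
    obtain pu wu where ru: "regular_solution \<alpha> lam (f n) (u n) pu wu"
      by (rule classical_solution_imp_regular[OF u_pde[OF n]])
    obtain pr wr where rr: "regular_solution \<alpha> lam (\<lambda>x t. 0) uref pr wr"
      by (rule classical_solution_imp_regular[OF uref_pde])
    note reg = regular_solution_diff[OF ru rr]
    have bound: "\<bar>u n x s - uref x s\<bar> \<le> M * exp (- \<sigma> * s)" if x: "x \<in> {0..1}" and s: "s \<in> {0..T}" for x s
    proof (rule maximum_principle_abs[OF reg alpha ls(2,3), where b = "U1 n" and l = l])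
      show "\<bar>u n x 0 - uref x 0\<bar> \<le> M" if "x \<in> {0..1}" for x
        using init_ut[OF n that] G_ge parts kE nonneg unfolding ut M_def by linarith
      have FM: "H * F / (lam - \<sigma>) \<le> M"
        using G_ge parts kE nonneg F2 unfolding M_def by linarith
      show "\<bar>f n x t - 0\<bar> \<le> (lam - \<sigma>) * (M * exp (- \<sigma> * t))" if "x \<in> {0..1}" "t \<in> {0<..s}" for x t
        using F_scale[OF n that(1) _ FM, of t] that s by simp
      show "pu 0 t - pr 0 t = 0 \<or> \<bar>u n 0 t - uref 0 t\<bar> \<le> M * exp (- \<sigma> * t)" if "t \<in> {0<..s}" for t
      proof (rule disjI2)
        have t: "t > 0" "t \<ge> 0" "t \<in> {0..T}" using that s by auto
        \<comment> \<open>The reference value r is rewritten by the control law and U0 by the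
          boundary value of \<open>v\<close>, so that the observer error appears.\<close>
        have "u n 0 t - uref 0 t = (u n 0 t - v n 0 t - qh n 0 t) + d0 n t"
          using uref_bc[OF t(1)] v_bc[OF n t(1)] U0[OF n t(2)] by simp
        moreover have "\<bar>d0 n t\<bar> \<le> (H * D0) * exp (- \<sigma> * t)"
          using D0[OF n t(3)] scale[of D0 "H * D0" t] nonneg t by (simp add: mult.commute)
        moreover have "(B + H * F / (lam - \<sigma>) + H * D0) * exp (- \<sigma> * t) \<le> M * exp (- \<sigma> * t)"
        proof (rule mult_right_mono)
          show "B + H * F / (lam - \<sigma>) + H * D0 \<le> M"
            using G_ge parts kE nonneg F2 unfolding M_def by linarith
        qed simp
        ultimately show "\<bar>u n 0 t - uref 0 t\<bar> \<le> M * exp (- \<sigma> * t)"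
          using obs[OF n t(3)] unfolding distrib_right by linarith
      qed
      show "pu 1 t - pr 1 t = - l * (u n 1 t - uref 1 t) + U1 n t" if "t \<in> {0<..s}" for t
        using u_bc[OF n, of t] uref_bc[of t] that
        by (simp add: regular_solution_dx[OF ru] regular_solution_dx[OF rr] algebra_simps)
      show "\<bar>U1 n t\<bar> \<le> l * (M * exp (- \<sigma> * t))" if "t \<in> {0<..s}" for t
      proof -
        have t: "t \<ge> 0" "t \<in> {0..T}" using that s by auto
        \<comment> \<open>The coupling: the Robin datum is the gain times the tracking error of the
          predecessor. Division by \<open>l\<close> in the comparison yields the contraction factor
          \<open>k n / l\<close>.\<close>
        have "U1 n t = k n * ut n' 1 t + d1 n t" using U1[OF n t(1)] by (simp add: ut n'_def)
        then have "\<bar>U1 n t\<bar> \<le> k n * \<bar>ut n' 1 t\<bar> + \<bar>d1 n t\<bar>"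
          using abs_triangle_ineq[of "k n * ut n' 1 t" "d1 n t"] kn by (simp add: abs_mult)
        also have "k n * \<bar>ut n' 1 t\<bar> \<le> k n * (E n' * exp (- \<sigma> * t))"
          using E_upper[OF n', of 1 t] t kn by (intro mult_left_mono) auto
        also have "\<bar>d1 n t\<bar> \<le> (H * D1) * exp (- \<sigma> * t)"
          using D1[OF n t(2)] scale[of D1 "H * D1" t] nonneg t by (simp add: mult.commute)
        also have "k n * (E n' * exp (- \<sigma> * t)) + H * D1 * exp (- \<sigma> * t)
            = l * ((H * (1 / l * D1) + k n / l * E n') * exp (- \<sigma> * t))"
          using lpos by (simp add: field_simps)
        also have "\<dots> \<le> l * (M * exp (- \<sigma> * t))"
        proof (intro mult_left_mono mult_right_mono)
          show "H * (1 / l * D1) + k n / l * E n' \<le> M"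
            using G_ge parts kE nonneg unfolding M_def by linarith
        qed (use lpos in auto)
        finally show ?thesis by simp
      qed
    qed (use x s lpos in auto)
    have "E n \<le> M"
      unfolding E_def
    proof (rule C_norm_least)
      show "{0..1::real} \<times> {0..T} \<noteq> {}" using T by auto
      fix z assume "z \<in> {0..1::real} \<times> {0..T}"
      then obtain x s where z: "z = (x, s)" "x \<in> {0..1}" "s \<in> {0..T}" by auto
      have "exp (\<sigma> * s) * \<bar>ut n x s\<bar> \<le> M"
        using bound[OF z(2,3)] by (simp add: ut exp_minus field_simps)
      then show "\<bar>case z of (x, s) \<Rightarrow> exp (\<sigma> * s) * ut n x s\<bar> \<le> M" by (simp add: z abs_mult)
    qed
    then show ?thesis by (simp add: M_def n'_def)
  qed

  have "G \<ge> 0" using G_ge parts nonneg by linarith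
  then have Ei: "E i \<le> C_tilde N k l i * G"
    using M_cyc_bound[of N k l G E i] N gains step i by blast
  have "C_norm {0..1} (\<lambda>x. ut i x T) \<le> E i * exp (- \<sigma> * T)"
    using E_upper[OF i] T by (intro C_norm_least) auto
  also have "\<dots> \<le> C_tilde N k l i * G * exp (- \<sigma> * T)"
    using Ei by (intro mult_right_mono) auto
  also have "\<dots> = C_tilde N k l i * D_fun N l lam \<sigma> f d0 d1 T * (H * exp (- \<sigma> * T))
      + C_tilde N k l i * exp (- \<sigma> * T) * (A + B)"
    unfolding G_def by (simp add: algebra_simps)
  also have "H * exp (- \<sigma> * T) = 1" by (simp add: H_def exp_minus)
  finally show "C_norm {0..1} (\<lambda>x. ut i x T)
     \<le> C_tilde N k l i * D_fun N l lam \<sigma> f d0 d1 T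
       + C_tilde N k l i * exp (- \<sigma> * T) *
           (Max ((\<lambda>n. C_norm {0..1} (ut0 n)) ` {1..N})
            + Max ((\<lambda>n. C_norm {0..1} (\<lambda>x. u0 n x - v0 n x - qh0 n x)) ` {1..N}))"
    by (simp add: A_def B_def)
qed

end
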